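(* Under the hypotheses of Theorem 1 (connectivity-based model, $d\in\{2,3\}$, $\alpha\in(0,1]$, $\beta\in[0,d)$, $R>(1/\alpha)^{1/d}R_{\mathrm{MDS}}$ with $R_{\mathrm{MDS}}=32\left(\frac{12\log n}{\alpha(n-2)}\right)^{1/d}$), with high probability $$\min_{S\in\mathbb R^{d\times d}}\frac{1}{\sqrt n}\|LX-L\widehat X S\|_F\le \sqrt6\left(\frac{R_{\mathrm{MDS}}}{R}+20R\right).$$
   Context: Model: $n$ nodes at positions $x_1,\dots,x_n$ i.i.d. uniform in $[0,1]^d$; $X$ is the $n\times d$ matrix with rows $x_i$; $d_{i,j}=\|x_i-x_j\|$. Detection function $p(z)=\min\{1,\alpha(z/R)^{-\beta}\}$. Connectivity-based model: independently for each pair, $\{i,j\}$ is an edge of $G$ with probability $p(d_{i,j})$ if $d_{i,j}\le R$ and never if $d_{i,j}>R$; only $G$ is observed. $h_{i,j}$ is the hop count (graph distance) in $G$ and $\hat d_{i,j}=Rh_{i,j}$. MDS-MAP: $\widehat D_{ij}=\hat d_{i,j}^2$ ($i\ne j$), $\widehat D_{ii}=0$; $L=I_n-\frac1n\mathbf 1_n\mathbf 1_n^T$; $M=-\tfrac12 L\widehat DL$; $\widehat X=U_d\Sigma_d^{1/2}$ where $U_d\Sigma_dU_d^T$ is the best rank-$d$ approximation of $M$ (top $d$ eigenvalues and orthonormal eigenvectors). $\|\cdot\|_F$ is the Frobenius norm. *)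

theory Defs
  imports "HOL-Probability.Probability"
begin

definition detect :: "real \<Rightarrow> real \<Rightarrow> real \<Rightarrow> real \<Rightarrow> real" where
  "detect \<alpha> \<beta> R z = min 1 (\<alpha> * (z / R) powr (- \<beta>))"

text \<open>Edge of G: positions x, auxiliary uniform variables U indexed by pairs (i,j), i<j.
  Given positions, the pair {i,j} is an edge independently with probability p(d_ij) if
  d_ij \<le> R, never otherwise.\<close>
definition edge :: "real \<Rightarrow> real \<Rightarrow> real \<Rightarrow> (nat \<Rightarrow> 'a::metric_space) \<Rightarrow> (nat \<times> nat \<Rightarrow> real)
    \<Rightarrow> nat \<Rightarrow> nat \<Rightarrow> bool" where
  "edge \<alpha> \<beta> R x U i j \<longleftrightarrow> i \<noteq> j \<and> dist (x i) (x j) \<le> R \<and>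
     U (min i j, max i j) < detect \<alpha> \<beta> R (dist (x i) (x j))"

definition is_walk :: "nat \<Rightarrow> (nat \<Rightarrow> nat \<Rightarrow> bool) \<Rightarrow> nat list \<Rightarrow> bool" where
  "is_walk n E ps \<longleftrightarrow> ps \<noteq> [] \<and> set ps \<subseteq> {..<n} \<and>
     (\<forall>k < length ps - 1. E (ps ! k) (ps ! (k + 1)))"

definition graph_connected :: "nat \<Rightarrow> (nat \<Rightarrow> nat \<Rightarrow> bool) \<Rightarrow> bool" where
  "graph_connected n E \<longleftrightarrow> (\<forall>i<n. \<forall>j<n. \<exists>ps. is_walk n E ps \<and> hd ps = i \<and> last ps = j)"

definition hop :: "nat \<Rightarrow> (nat \<Rightarrow> nat \<Rightarrow> bool) \<Rightarrow> nat \<Rightarrow> nat \<Rightarrow> nat" where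
  "hop n E i j = (LEAST k. \<exists>ps. is_walk n E ps \<and> hd ps = i \<and> last ps = j \<and> length ps = k + 1)"

definition centering :: "nat \<Rightarrow> nat \<Rightarrow> nat \<Rightarrow> real" where
  "centering n i j = (if i = j then 1 else 0) - 1 / real n"

definition Dhat :: "nat \<Rightarrow> real \<Rightarrow> (nat \<Rightarrow> nat \<Rightarrow> bool) \<Rightarrow> nat \<Rightarrow> nat \<Rightarrow> real" where
  "Dhat n R E k l = (if k = l then 0 else (R * real (hop n E k l))\<^sup>2)"

definition mds_gram :: "nat \<Rightarrow> real \<Rightarrow> (nat \<Rightarrow> nat \<Rightarrow> bool) \<Rightarrow> nat \<Rightarrow> nat \<Rightarrow> real" where
  "mds_gram n R E i j =
     - (1/2) * (\<Sum>k<n. \<Sum>l<n. centering n i k * Dhat n R E k l * centering n l j)"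

text \<open>Xh is an output of MDS-MAP for M: take an orthonormal eigenbasis V_0..V_{n-1} of M with
  eigenvalues mu_0 \<ge> ... \<ge> mu_{n-1}; the columns of Xh are V_j sqrt(mu_j) for the top d
  indices j (negative eigenvalues are clipped to 0 before taking the square root).\<close>
definition mds_output :: "nat \<Rightarrow> (nat \<Rightarrow> nat \<Rightarrow> real) \<Rightarrow> (nat \<Rightarrow> real^'d::finite) \<Rightarrow> bool" where
  "mds_output n M Xh \<longleftrightarrow>
     (\<exists>(V :: nat \<Rightarrow> nat \<Rightarrow> real) (\<mu> :: nat \<Rightarrow> real) (e :: 'd \<Rightarrow> nat).
        (\<forall>j<n. \<forall>j'<n. (\<Sum>i<n. V j i * V j' i) = (if j = j' then 1 else 0)) \<and>
        (\<forall>j<n. \<forall>i<n. (\<Sum>l<n. M i l * V j l) = \<mu> j * V j i) \<and>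
        (\<forall>j j'. j \<le> j' \<and> j' < n \<longrightarrow> \<mu> j' \<le> \<mu> j) \<and>
        bij_betw e UNIV {..<CARD('d)} \<and>
        (\<forall>i<n. Xh i = (\<chi> k. V (e k) i * sqrt (max 0 (\<mu> (e k))))))"

text \<open>Row i of L X.\<close>
definition centered :: "nat \<Rightarrow> (nat \<Rightarrow> real^'d::finite) \<Rightarrow> nat \<Rightarrow> real^'d" where
  "centered n X i = X i - (1 / real n) *\<^sub>R (\<Sum>j<n. X j)"

definition frob_dev :: "nat \<Rightarrow> (nat \<Rightarrow> real^'d::finite) \<Rightarrow> (nat \<Rightarrow> real^'d) \<Rightarrow> real^'d^'d \<Rightarrow> real" where
  "frob_dev n X Xh S = sqrt (\<Sum>i<n. \<Sum>k\<in>UNIV.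
      (centered n X i $ k - (\<Sum>l\<in>UNIV. centered n Xh i $ l * S $ l $ k))\<^sup>2)"

definition R_MDS :: "real \<Rightarrow> nat \<Rightarrow> nat \<Rightarrow> real" where
  "R_MDS \<alpha> d n = 32 * (12 * ln (real n) / (\<alpha> * (real n - 2))) powr (1 / real d)"

definition sample_space :: "nat \<Rightarrow> ((nat \<Rightarrow> real^'d::finite) \<times> (nat \<times> nat \<Rightarrow> real)) measure" where
  "sample_space n =
     (PiM {..<n} (\<lambda>_. uniform_measure lborel (cbox 0 One)))
     \<Otimes>\<^sub>M (PiM {(i, j). i < j \<and> j < n} (\<lambda>_. uniform_measure lborel {0..1::real}))"

definition good_event :: "real \<Rightarrow> real \<Rightarrow> real \<Rightarrow> nat
    \<Rightarrow> ((nat \<Rightarrow> real^'d::finite) \<times> (nat \<times> nat \<Rightarrow> real)) \<Rightarrow> bool" where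
  "good_event \<alpha> \<beta> R n \<omega> \<longleftrightarrow>
     (let x = fst \<omega>; U = snd \<omega>; E = edge \<alpha> \<beta> R x U in
       graph_connected n E \<and>
       (\<forall>Xh. mds_output n (mds_gram n R E) Xh \<longrightarrow>
          (INF S. frob_dev n x Xh S) / sqrt (real n)
            \<le> sqrt 6 * (R_MDS \<alpha> CARD('d) n / R + 20 * R)))"

end

theory Submission
  imports Defs "HOL-Real_Asymp.Real_Asymp"
begin

text \<open>
  Hop counts. Write \<open>R\<^sub>M\<^sub>D\<^sub>S = 32 r\<^sub>0\<close>. Every pair at distance at most \<open>R\<close> is joined with probability
  at least \<open>\<alpha>\<close>. A cube of side \<open>s\<close> contains no suitable neighbour of a given node with probability at
  most \<open>(1 - \<alpha> s^d)^(n - 2)\<close>, so with \<open>s = 3/5 r\<^sub>0\<close>, with high probability every node \<open>k\<close> has, for every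
  destination \<open>j\<close>, a neighbour that is closer to \<open>j\<close> by \<open>\<rho> = R - 2 s \<surd>d\<close>. Likewise the condition on \<open>R\<close>
  makes \<open>\<alpha>\<^sup>2 n R^d\<close> large enough for any two nodes at distance at most \<open>R\<close> to have a common neighbour.
  Greedy routing then gives \<open>d\<^sub>k\<^sub>j \<le> R h\<^sub>k\<^sub>j \<le> (R / \<rho>) d\<^sub>k\<^sub>j + 2 R\<close>, so for
  \<open>R \<le> 1/25\<close> all squared distances are known up to \<open>(R\<^sub>M\<^sub>D\<^sub>S / R + 20 R) / 2\<close>; for larger \<open>R\<close> the
  claim is trivial.

  Linear algebra. Let \<open>Y = L X\<close>, and let \<open>E = M - Y Y\<^sup>T\<close>, which satisfies \<open>2 |E|\<^sub>F \<le> |Dhat - D|\<^sub>F\<close> since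
  double centering is a contraction. With the best \<open>S\<close>, the squared deviation is the sum of
  \<open>|Y\<^sup>T V\<^sub>j|\<^sup>2\<close> over the eigenvectors not used by the output. If \<open>Y\<^sup>T Y \<ge> \<sigma>\<close>, then
  \<open>\<sigma> |Y\<^sup>T V\<^sub>j|\<^sup>2 \<le> |Y Y\<^sup>T V\<^sub>j|\<^sup>2 = |\<mu>\<^sub>j V\<^sub>j - E V\<^sub>j|\<^sup>2\<close>, and the discarded eigenvalues satisfy
  \<open>\<Sum> \<mu>\<^sub>j\<^sup>2 \<le> |E|\<^sub>F\<^sup>2\<close> by Eckart--Young. Hence the squared deviation is at most \<open>4 |E|\<^sub>F\<^sup>2 / \<sigma>\<close>. The covariance
  of the uniform distribution on the cube is \<open>1/12\<close> times the identity, so \<open>\<sigma> = n / 24\<close> is admissible with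
  high probability, by Hoeffding's inequality.
\<close>

subsection \<open>Perturbed Gram matrices\<close>

locale orthonormal_system =
  fixes n :: nat and V :: "nat \<Rightarrow> nat \<Rightarrow> real"
  assumes orth: "\<And>j j'. j < n \<Longrightarrow> j' < n \<Longrightarrow> (\<Sum>i<n. V j i * V j' i) = (if j = j' then 1 else 0)"
begin

text \<open>Pythagoras: the cross term and the square of the projection both equal the sum of the
  squared coefficients. With all indices this yields Bessel's inequality; with a proper subset it
  measures what a truncated eigenbasis misses.\<close>

lemma residual_square_sum:
  fixes f :: "nat \<Rightarrow> real"
  assumes J: "J \<subseteq> {..<n}"
  defines "c \<equiv> \<lambda>j. \<Sum>i<n. V j i * f i"
  shows "(\<Sum>i<n. (f i - (\<Sum>j\<in>J. c j * V j i))\<^sup>2) = (\<Sum>i<n. (f i)\<^sup>2) - (\<Sum>j\<in>J. (c j)\<^sup>2)"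
proof -
  have fin: "finite J" using J finite_subset by blast
  have cross: "(\<Sum>i<n. f i * (\<Sum>j\<in>J. c j * V j i)) = (\<Sum>j\<in>J. (c j)\<^sup>2)"
  proof -
    have "(\<Sum>i<n. f i * (\<Sum>j\<in>J. c j * V j i)) = (\<Sum>i<n. \<Sum>j\<in>J. c j * (V j i * f i))"
      by (simp add: sum_distrib_left algebra_simps)
    also have "\<dots> = (\<Sum>j\<in>J. \<Sum>i<n. c j * (V j i * f i))" by (rule sum.swap)
    also have "\<dots> = (\<Sum>j\<in>J. (c j)\<^sup>2)"
      by (simp add: c_def power2_eq_square sum_distrib_left[symmetric])
    finally show ?thesis .
  qed
  have square: "(\<Sum>i<n. (\<Sum>j\<in>J. c j * V j i)\<^sup>2) = (\<Sum>j\<in>J. (c j)\<^sup>2)"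
  proof -
    have "(\<Sum>i<n. (\<Sum>j\<in>J. c j * V j i)\<^sup>2) = (\<Sum>i<n. \<Sum>j\<in>J. \<Sum>j'\<in>J. c j * c j' * (V j i * V j' i))"
      by (simp add: power2_eq_square sum_product algebra_simps)
    also have "\<dots> = (\<Sum>j\<in>J. \<Sum>i<n. \<Sum>j'\<in>J. c j * c j' * (V j i * V j' i))"
      by (rule sum.swap)
    also have "\<dots> = (\<Sum>j\<in>J. \<Sum>j'\<in>J. \<Sum>i<n. c j * c j' * (V j i * V j' i))"
      by (intro sum.cong refl sum.swap)
    also have "\<dots> = (\<Sum>j\<in>J. \<Sum>j'\<in>J. c j * c j' * (if j = j' then 1 else 0))"
      unfolding sum_distrib_left[symmetric] using J by (intro sum.cong refl) (auto simp: orth subset_iff)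
    also have "\<dots> = (\<Sum>j\<in>J. (c j)\<^sup>2)"
      using fin by (simp add: if_distrib[of "(*) _"] power2_eq_square cong: if_cong)
    finally show ?thesis .
  qed
  have "(\<Sum>i<n. (f i - (\<Sum>j\<in>J. c j * V j i))\<^sup>2) =
      (\<Sum>i<n. (f i)\<^sup>2) - 2 * (\<Sum>i<n. f i * (\<Sum>j\<in>J. c j * V j i)) + (\<Sum>i<n. (\<Sum>j\<in>J. c j * V j i)\<^sup>2)"
    by (simp add: power2_diff sum.distrib sum_subtractf sum_distrib_left algebra_simps)
  then show ?thesis using cross square by simp
qed

lemma bessel: "(\<Sum>j<n. (\<Sum>i<n. V j i * f i)\<^sup>2) \<le> (\<Sum>i<n. (f i)\<^sup>2)"
proof -
  have "0 \<le> (\<Sum>i<n. (f i - (\<Sum>j<n. (\<Sum>i<n. V j i * f i) * V j i))\<^sup>2)"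
    by (intro sum_nonneg) auto
  then show ?thesis using residual_square_sum[of "{..<n}" f] by simp
qed

text \<open>Each defect \<open>1 - (\<Sum>j<n. (V j i)\<^sup>2)\<close> is nonnegative by Bessel, and the defects
  add up to \<open>n - n = 0\<close>; hence the rows of the square array are orthonormal as well.\<close>
lemma completeness:
  assumes "i < n" "l < n"
  shows "(\<Sum>j<n. V j i * V j l) = (if i = l then 1 else 0)"
proof -
  define u where "u i = (\<lambda>l. if l = i then 1 else 0 :: real)" for i :: nat
  have cu: "(\<Sum>k<n. V j k * u i k) = V j i" if "i < n" for i j
    using that by (simp add: u_def if_distrib[of "(*) _"] cong: if_cong)
  have nu: "(\<Sum>k<n. (u i k)\<^sup>2) = 1" if "i < n" for i
    using that by (simp add: u_def if_distrib[of "\<lambda>x. x\<^sup>2"] cong: if_cong)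
  have le: "(\<Sum>j<n. (V j i)\<^sup>2) \<le> 1" if "i < n" for i
    using bessel[of "u i"] nu[OF that] cu[OF that] by simp
  have "(\<Sum>i<n. 1 - (\<Sum>j<n. (V j i)\<^sup>2)) = real n - (\<Sum>j<n. \<Sum>i<n. (V j i)\<^sup>2)"
    by (subst sum.swap) (simp add: sum_subtractf)
  also have "(\<Sum>j<n. \<Sum>i<n. (V j i)\<^sup>2) = real n"
    by (simp add: power2_eq_square orth)
  finally have "(\<Sum>i<n. 1 - (\<Sum>j<n. (V j i)\<^sup>2)) = 0" by simp
  then have one: "(\<Sum>j<n. (V j i)\<^sup>2) = 1"
    using le \<open>i < n\<close> by (subst (asm) sum_nonneg_eq_0_iff) auto
  have "(\<Sum>k<n. (u i k - (\<Sum>j<n. (\<Sum>k<n. V j k * u i k) * V j k))\<^sup>2) = 0"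
    using residual_square_sum[of "{..<n}" "u i"] nu[OF \<open>i < n\<close>] cu[OF \<open>i < n\<close>] one by simp
  then have "u i l - (\<Sum>j<n. V j i * V j l) = 0"
    using \<open>l < n\<close> cu[OF \<open>i < n\<close>] by (subst (asm) sum_nonneg_eq_0_iff) auto
  then show ?thesis by (auto simp: u_def)
qed

lemma parseval: "(\<Sum>j<n. (\<Sum>i<n. V j i * f i)\<^sup>2) = (\<Sum>i<n. (f i)\<^sup>2)"
proof -
  have "(\<Sum>j<n. (\<Sum>i<n. V j i * f i)\<^sup>2) = (\<Sum>j<n. \<Sum>i<n. \<Sum>l<n. f i * f l * (V j i * V j l))"
    by (simp add: power2_eq_square sum_product algebra_simps)
  also have "\<dots> = (\<Sum>i<n. \<Sum>j<n. \<Sum>l<n. f i * f l * (V j i * V j l))" by (rule sum.swap)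
  also have "\<dots> = (\<Sum>i<n. \<Sum>l<n. \<Sum>j<n. f i * f l * (V j i * V j l))"
    by (intro sum.cong refl sum.swap)
  also have "\<dots> = (\<Sum>i<n. \<Sum>l<n. f i * f l * (if i = l then 1 else 0))"
    unfolding sum_distrib_left[symmetric] by (intro sum.cong refl) (auto simp: completeness)
  also have "\<dots> = (\<Sum>i<n. (f i)\<^sup>2)"
    by (simp add: if_distrib[of "(*) _"] power2_eq_square cong: if_cong)
  finally show ?thesis .
qed

end

section \<open>Eigenvalues of a perturbed Gram matrix\<close>

text \<open>Weights of at most 1 with total \<open>d\<close> are best spent on the \<open>d\<close>
  largest entries; this is the discrete core of Ky Fan's trace inequality.\<close>

lemma weighted_sum_le_head_sum:
  fixes a p :: "nat \<Rightarrow> real"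
  assumes "0 < d" "d \<le> n"
    and mono: "\<And>j j'. j \<le> j' \<Longrightarrow> j' < n \<Longrightarrow> a j' \<le> a j"
    and p: "\<And>j. j < n \<Longrightarrow> 0 \<le> p j" "\<And>j. j < n \<Longrightarrow> p j \<le> 1" and sum_p: "(\<Sum>j<n. p j) = real d"
  shows "(\<Sum>j<n. a j * p j) \<le> (\<Sum>j<d. a j)"
proof -
  \<comment> \<open>Both weightings have total mass \<open>d\<close>, so subtracting the threshold
    \<open>t\<close> shifts both sides equally and makes the comparison termwise.\<close>
  define t where "t = a (d - 1)"
  have "(\<Sum>j<n. (a j - t) * p j) \<le> (\<Sum>j<n. if j < d then a j - t else 0)"
  proof (rule sum_mono)
    fix j assume "j \<in> {..<n}"
    then have j: "j < n" by simp
    show "(a j - t) * p j \<le> (if j < d then a j - t else 0)"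
    proof (cases "j < d")
      case True
      then have "t \<le> a j" unfolding t_def using assms by (intro mono) auto
      then show ?thesis using True p(2)[OF j] mult_left_mono[of "p j" 1 "a j - t"] by simp
    next
      case False
      then have "a j \<le> t" unfolding t_def using assms j by (intro mono) auto
      then show ?thesis using False p(1)[OF j] by (simp add: mult_nonpos_nonneg)
    qed
  qed
  also have "\<dots> = (\<Sum>j<d. a j - t)"
    using \<open>d \<le> n\<close> by (intro sum.mono_neutral_cong_right) auto
  finally show ?thesis using sum_p
    by (simp add: left_diff_distrib sum_subtractf sum_distrib_left[symmetric])
qed

text \<open>Let \<open>Y\<close> be the matrix with rows \<open>y i\<close>. In this locale \<open>z j = Y\<^sup>T V\<^sub>j\<close>, \<open>A = Y\<^sup>T Y\<close> with
  inverse \<open>B\<close>, \<open>err = M - Y Y\<^sup>T\<close>, \<open>res j = err V\<^sub>j\<close>, and \<open>p j\<close> is the squared norm of the projection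
  of \<open>V\<^sub>j\<close> onto the range of \<open>Y\<close>.\<close>
locale gram_perturbation = orthonormal_system +
  fixes M :: "nat \<Rightarrow> nat \<Rightarrow> real" and \<mu> :: "nat \<Rightarrow> real" and y :: "nat \<Rightarrow> 'a::euclidean_space"
    and \<sigma> :: real
  assumes eig: "\<And>i j. i < n \<Longrightarrow> j < n \<Longrightarrow> (\<Sum>l<n. M i l * V j l) = \<mu> j * V j i"
    and dec: "\<And>j j'. j \<le> j' \<Longrightarrow> j' < n \<Longrightarrow> \<mu> j' \<le> \<mu> j"
    and dim_le: "DIM('a) \<le> n"
    and \<sigma>_pos: "0 < \<sigma>"
    and moment_ge: "\<And>w. \<sigma> * (w \<bullet> w) \<le> (\<Sum>i<n. (y i \<bullet> w)\<^sup>2)"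
begin

definition z :: "nat \<Rightarrow> 'a" where "z j = (\<Sum>i<n. V j i *\<^sub>R y i)"

definition err :: "nat \<Rightarrow> nat \<Rightarrow> real" where "err i l = M i l - y i \<bullet> y l"

definition res :: "nat \<Rightarrow> nat \<Rightarrow> real" where "res j i = \<mu> j * V j i - y i \<bullet> z j"

definition A :: "'a \<Rightarrow> 'a" where "A w = (\<Sum>i<n. (y i \<bullet> w) *\<^sub>R y i)"

lemma res_eq:
  assumes "i < n" "j < n"
  shows "res j i = (\<Sum>l<n. V j l * err i l)"
  using eig[OF assms]
  by (simp add: res_def err_def z_def inner_sum_right algebra_simps sum_subtractf)

text \<open>For fixed \<open>i\<close> the numbers \<open>res j i\<close> are the coefficients of
  row \<open>i\<close> of \<open>err\<close> in the basis \<open>V\<close>, so Parseval applies row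
  by row.\<close>

lemma sum_res_square: "(\<Sum>j<n. \<Sum>i<n. (res j i)\<^sup>2) = (\<Sum>i<n. \<Sum>l<n. (err i l)\<^sup>2)"
proof -
  have "(\<Sum>j<n. \<Sum>i<n. (res j i)\<^sup>2) = (\<Sum>i<n. \<Sum>j<n. (\<Sum>l<n. V j l * err i l)\<^sup>2)"
    by (subst sum.swap) (simp add: res_eq)
  then show ?thesis by (simp add: parseval)
qed

lemma inner_A: "w \<bullet> A w' = (\<Sum>i<n. (y i \<bullet> w) * (y i \<bullet> w'))"
  unfolding A_def inner_sum_right inner_scaleR_right
  by (simp add: inner_commute[of w] mult.commute)

lemma linear_A: "linear A"
proof (rule linearI)
  show "A (v + w) = A v + A w" for v w
    unfolding A_def inner_add_right scaleR_add_left sum.distrib ..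
  show "A (c *\<^sub>R v) = c *\<^sub>R A v" for c v
    unfolding A_def inner_scaleR_right scaleR_scaleR[symmetric] scaleR_sum_right ..
qed

text \<open>The moment bound makes \<open>A\<close> positive definite, hence injective, and an
  injective endomorphism of a finite-dimensional space is onto.\<close>

lemma A_surj: "\<exists>w. A w = v"
proof -
  have "inj A"
  proof (subst linear_injective_0[OF linear_A], intro allI impI)
    fix w assume "A w = 0"
    then have "(\<Sum>i<n. (y i \<bullet> w)\<^sup>2) = 0" using inner_A[of w w] by (simp add: power2_eq_square)
    then have "\<sigma> * (w \<bullet> w) \<le> 0" using moment_ge[of w] by simp
    then show "w = 0" using \<sigma>_pos by (simp add: mult_le_0_iff) (metis inner_gt_zero_iff not_le)
  qed
  then have "surj A" using linear_A linear_inj_imp_surj by blast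
  then show ?thesis by (metis surjD)
qed

definition B :: "'a \<Rightarrow> 'a" where "B v = (SOME w. A w = v)"

lemma A_B [simp]: "A (B v) = v"
  unfolding B_def using A_surj by (rule someI_ex)

lemma A_sym: "A w \<bullet> w' = w \<bullet> A w'"
  unfolding inner_commute[of "A w"] inner_A by (simp only: mult.commute)

lemma B_sym: "B v \<bullet> v' = v \<bullet> B v'"
  by (metis A_B A_sym)

lemma linear_B: "linear B"
proof -
  have inj: "w = w'" if "A w = A w'" for w w'
  proof -
    have "A (w - w') = 0" using that by (simp add: linear_diff[OF linear_A])
    then have "(\<Sum>i<n. (y i \<bullet> (w - w'))\<^sup>2) = 0"
      using inner_A[of "w - w'" "w - w'"] by (simp add: power2_eq_square)
    then have "\<sigma> * ((w - w') \<bullet> (w - w')) \<le> 0" using moment_ge[of "w - w'"] by simp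
    then show ?thesis using \<sigma>_pos
      by (simp add: mult_le_0_iff) (metis eq_iff_diff_eq_0 inner_gt_zero_iff not_le)
  qed
  show ?thesis
    by (intro linearI; rule inj) (simp_all add: linear_add[OF linear_A] linear_scale[OF linear_A])
qed

definition p :: "nat \<Rightarrow> real" where "p j = z j \<bullet> B (z j)"

lemma p_eq: "p j = (\<Sum>i<n. (y i \<bullet> B (z j))\<^sup>2)"
  using inner_A[of "B (z j)" "B (z j)"] unfolding p_def A_B inner_commute[of "z j"]
  by (simp add: power2_eq_square)

lemma z_inner: "z j \<bullet> w = (\<Sum>i<n. V j i * (y i \<bullet> w))"
  by (simp add: z_def inner_sum_left)

lemma p_eq': "p j = (\<Sum>i<n. V j i * (y i \<bullet> B (z j)))"
  unfolding p_def by (rule z_inner)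

lemma p_nonneg: "0 \<le> p j"
  by (simp add: p_eq sum_nonneg)

lemma norm_V: "j < n \<Longrightarrow> (\<Sum>i<n. (V j i)\<^sup>2) = 1"
  using orth[of j j] by (simp add: power2_eq_square)

lemma proj_compl: "j < n \<Longrightarrow> (\<Sum>i<n. (V j i - y i \<bullet> B (z j))\<^sup>2) = 1 - p j"
proof -
  assume "j < n"
  have "(\<Sum>i<n. (V j i - y i \<bullet> B (z j))\<^sup>2) = (\<Sum>i<n. (V j i)\<^sup>2) - 2 * p j + p j"
    unfolding power2_diff sum.distrib sum_subtractf by (simp add: p_eq[symmetric])
      (simp add: p_eq' sum_distrib_left algebra_simps)
  then show ?thesis using norm_V[OF \<open>j < n\<close>] by simp
qed

lemma p_le_1: "j < n \<Longrightarrow> p j \<le> 1"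
  using proj_compl[of j] sum_nonneg[of "{..<n}" "\<lambda>i. (V j i - y i \<bullet> B (z j))\<^sup>2"] by simp

text \<open>The left side is the trace of the projection \<open>Y B Y\<^sup>T\<close>; cyclicity
  turns it into the trace of \<open>A\<close> composed with \<open>B\<close>, the identity.\<close>

lemma sum_p: "(\<Sum>j<n. p j) = real DIM('a)"
proof -
  have B_z: "B (z j) = (\<Sum>l<n. V j l *\<^sub>R B (y l))" for j
    unfolding z_def linear_sum[OF linear_B] linear_scale[OF linear_B] ..
  have "p j = (\<Sum>i<n. \<Sum>l<n. (y i \<bullet> B (y l)) * (V j i * V j l))" for j
    unfolding p_def B_z unfolding z_def inner_sum_left
    by (intro sum.cong refl) (simp add: inner_sum_right sum_distrib_left mult_ac)
  then have "(\<Sum>j<n. p j) = (\<Sum>j<n. \<Sum>i<n. \<Sum>l<n. (y i \<bullet> B (y l)) * (V j i * V j l))"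
    by simp
  also have "\<dots> = (\<Sum>i<n. \<Sum>j<n. \<Sum>l<n. (y i \<bullet> B (y l)) * (V j i * V j l))" by (rule sum.swap)
  also have "\<dots> = (\<Sum>i<n. \<Sum>l<n. \<Sum>j<n. (y i \<bullet> B (y l)) * (V j i * V j l))"
    by (intro sum.cong refl sum.swap)
  also have "\<dots> = (\<Sum>i<n. \<Sum>l<n. (y i \<bullet> B (y l)) * (if i = l then 1 else 0))"
    unfolding sum_distrib_left[symmetric] by (intro sum.cong refl) (auto simp: completeness)
  also have "\<dots> = (\<Sum>i<n. y i \<bullet> B (y i))"
    by (simp add: if_distrib[of "(*) _"] cong: if_cong)
  \<comment> \<open>Expanding over \<open>Basis\<close> moves the trace from node indices to
    coordinates.\<close>
  also have "\<dots> = (\<Sum>i<n. \<Sum>b\<in>Basis. (y i \<bullet> B b) * (y i \<bullet> b))"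
    by (subst euclidean_inner) (simp add: B_sym mult.commute)
  also have "\<dots> = (\<Sum>b\<in>Basis. \<Sum>i<n. (y i \<bullet> B b) * (y i \<bullet> b))" by (rule sum.swap)
  also have "\<dots> = (\<Sum>b\<in>Basis. B b \<bullet> A b)" by (simp add: inner_A)
  also have "\<dots> = (\<Sum>b\<in>(Basis::'a set). 1)"
    by (intro sum.cong refl) (metis A_B A_sym inner_Basis)
  finally show ?thesis by simp
qed

text \<open>\<open>V j - (\<lambda>i. y i \<bullet> B (z j))\<close> is the component of the eigenvector orthogonal to the
  range of the Gram matrix, so only \<open>M\<close> contributes to its inner product with \<open>res j\<close>.\<close>
lemma eigenvalue_square_le:
  assumes j: "j < n"
  shows "(\<mu> j)\<^sup>2 * (1 - p j) \<le> (\<Sum>i<n. (res j i)\<^sup>2)"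
proof -
  have "(\<Sum>i<n. (y i \<bullet> z j) * (V j i - y i \<bullet> B (z j))) = 0"
  proof -
    have "(\<Sum>i<n. (y i \<bullet> z j) * (V j i - y i \<bullet> B (z j))) = z j \<bullet> z j - z j \<bullet> A (B (z j))"
      unfolding inner_A right_diff_distrib sum_subtractf z_inner[of j "z j"]
      by (simp only: mult.commute)
    then show ?thesis by simp
  qed
  moreover have "(\<Sum>i<n. \<mu> j * V j i * (V j i - y i \<bullet> B (z j))) = \<mu> j * (1 - p j)"
    using norm_V[OF j] p_eq'[of j]
    by (simp add: power2_eq_square right_diff_distrib sum_subtractf sum_distrib_left[symmetric] mult.assoc)
  ultimately have "(\<Sum>i<n. res j i * (V j i - y i \<bullet> B (z j))) = \<mu> j * (1 - p j)"
    by (simp add: res_def left_diff_distrib sum_subtractf)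
  then have "(\<mu> j * (1 - p j))\<^sup>2 \<le> (\<Sum>i<n. (res j i)\<^sup>2) * (1 - p j)"
    using Cauchy_Schwarz_ineq_sum[of "res j" "\<lambda>i. V j i - y i \<bullet> B (z j)" "{..<n}"]
    by (simp add: proj_compl[OF j])
  then have "((\<mu> j)\<^sup>2 * (1 - p j)) * (1 - p j) \<le> (\<Sum>i<n. (res j i)\<^sup>2) * (1 - p j)"
    by (simp add: power2_eq_square algebra_simps)
  moreover have "0 \<le> (\<Sum>i<n. (res j i)\<^sup>2)" by (simp add: sum_nonneg)
  \<comment> \<open>One factor \<open>1 - p j\<close> is cancelled; if it is zero, the left side
    vanishes and nonnegativity of the right side suffices.\<close>
  ultimately show ?thesis using p_le_1[OF j]
    by (cases "p j = 1") (auto simp: mult_le_cancel_right)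
qed

text \<open>Testing the residual against \<open>V j\<close> gives
  \<open>\<mu> j - z j \<bullet> z j\<close>. For \<open>\<mu> j \<le> 0\<close> the subtracted term
  only increases the absolute value, which reflects that the Gram matrix is positive
  semidefinite.\<close>

lemma negative_eigenvalue_square_le:
  assumes j: "j < n" and neg: "\<mu> j \<le> 0"
  shows "(\<mu> j)\<^sup>2 \<le> (\<Sum>i<n. (res j i)\<^sup>2)"
proof -
  have "(\<Sum>i<n. res j i * V j i) = \<mu> j - z j \<bullet> z j"
  proof -
    have "(\<Sum>i<n. res j i * V j i) = \<mu> j * (\<Sum>i<n. (V j i)\<^sup>2) - (\<Sum>i<n. V j i *\<^sub>R y i) \<bullet> z j"
      unfolding res_def left_diff_distrib sum_subtractf sum_distrib_left power2_eq_square
        inner_sum_left inner_scaleR_left by (simp only: mult_ac)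
    then show ?thesis using norm_V[OF j] by (simp add: z_def)
  qed
  moreover have "0 \<le> z j \<bullet> z j" by simp
  ultimately have "(\<mu> j)\<^sup>2 \<le> (\<Sum>i<n. res j i * V j i)\<^sup>2"
    using neg by (intro abs_le_square_iff[THEN iffD1]) linarith
  also have "\<dots> \<le> (\<Sum>i<n. (res j i)\<^sup>2)"
    using Cauchy_Schwarz_ineq_sum[of "res j" "V j" "{..<n}"] norm_V[OF j] by simp
  finally show ?thesis .
qed

text \<open>The indices whose eigenvectors do not contribute to the output: those beyond the
  dimension and those whose eigenvalue is clipped to 0.\<close>

definition tail :: "nat set" where "tail = {j. j < n \<and> (DIM('a) \<le> j \<or> \<mu> j \<le> 0)}"

lemma tail_subset: "tail \<subseteq> {..<n}" by (auto simp: tail_def)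

text \<open>A form of the Eckart--Young theorem: the Gram matrix is a positive semidefinite approximation
  of \<open>M\<close> of rank at most \<open>DIM('a)\<close>, hence not better than the optimal one.\<close>
lemma tail_eigenvalues_le: "(\<Sum>j\<in>tail. (\<mu> j)\<^sup>2) \<le> (\<Sum>i<n. \<Sum>l<n. (err i l)\<^sup>2)"
proof -
  \<comment> \<open>Only positive parts are squared: the sequence is then decreasing, which squares
    of eigenvalues of both signs need not be.\<close>
  define a where "a j = (max 0 (\<mu> j))\<^sup>2" for j
  have split: "{..<n} = tail \<union> {j. j < DIM('a) \<and> 0 < \<mu> j}" and disj: "tail \<inter> {j. j < DIM('a) \<and> 0 < \<mu> j} = {}"
    using dim_le by (auto simp: tail_def)
  have fin: "finite tail" using tail_subset finite_subset by blast
  have "(\<Sum>j<n. a j * p j) \<le> (\<Sum>j<DIM('a). a j)"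
  proof (rule weighted_sum_le_head_sum[OF _ dim_le])
    show "a j' \<le> a j" if "j \<le> j'" "j' < n" for j j'
      unfolding a_def using dec[OF that] by (intro power_mono) auto
  qed (auto simp: p_nonneg p_le_1 sum_p)
  also have "\<dots> = (\<Sum>j | j < DIM('a) \<and> 0 < \<mu> j. (\<mu> j)\<^sup>2)"
    by (rule sum.mono_neutral_cong_right) (auto simp: a_def)
  also have "\<dots> = (\<Sum>j<n. (\<mu> j)\<^sup>2) - (\<Sum>j\<in>tail. (\<mu> j)\<^sup>2)"
    unfolding split using fin disj by (subst sum.union_disjoint) auto
  finally have "(\<Sum>j\<in>tail. (\<mu> j)\<^sup>2) \<le> (\<Sum>j<n. (\<mu> j)\<^sup>2 - a j * p j)"
    by (simp add: sum_subtractf)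
  also have "\<dots> \<le> (\<Sum>j<n. \<Sum>i<n. (res j i)\<^sup>2)"
  proof (rule sum_mono)
    fix j assume "j \<in> {..<n}"
    then have j: "j < n" by simp
    \<comment> \<open>For a positive eigenvalue the left side is
      \<open>(\<mu> j)\<^sup>2 * (1 - p j)\<close>; for any other one \<open>a j\<close> is
      0.\<close>
    show "(\<mu> j)\<^sup>2 - a j * p j \<le> (\<Sum>i<n. (res j i)\<^sup>2)"
      using eigenvalue_square_le[OF j] negative_eigenvalue_square_le[OF j]
      by (cases "\<mu> j \<le> 0") (auto simp: a_def algebra_simps)
  qed
  finally show ?thesis by (simp add: sum_res_square)
qed

text \<open>Since \<open>y i \<bullet> z j = \<mu> j * V j i - res j i\<close>, applying
  \<open>moment_ge\<close> to \<open>z j\<close> leaves an eigenvalue part and a residual part.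
  Summed over the tail, each is at most twice the squared Frobenius norm of
  \<open>err\<close>.\<close>

lemma tail_component_le: "\<sigma> * (\<Sum>j\<in>tail. z j \<bullet> z j) \<le> 4 * (\<Sum>i<n. \<Sum>l<n. (err i l)\<^sup>2)"
proof -
  have "\<sigma> * (z j \<bullet> z j) \<le> 2 * (\<mu> j)\<^sup>2 + 2 * (\<Sum>i<n. (res j i)\<^sup>2)" if j: "j < n" for j
  proof -
    have "\<sigma> * (z j \<bullet> z j) \<le> (\<Sum>i<n. (\<mu> j * V j i - res j i)\<^sup>2)"
      using moment_ge[of "z j"] by (simp add: res_def)
    also have "\<dots> \<le> (\<Sum>i<n. 2 * (\<mu> j * V j i)\<^sup>2 + 2 * (res j i)\<^sup>2)"
      by (intro sum_mono) (smt (verit) power2_diff sum_squares_bound zero_le_power2 power2_sum)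
    also have "\<dots> = 2 * (\<mu> j)\<^sup>2 * (\<Sum>i<n. (V j i)\<^sup>2) + 2 * (\<Sum>i<n. (res j i)\<^sup>2)"
      by (simp add: sum.distrib sum_distrib_left power_mult_distrib mult.assoc)
    finally show ?thesis using norm_V[OF j] by simp
  qed
  then have "\<sigma> * (\<Sum>j\<in>tail. z j \<bullet> z j) \<le> (\<Sum>j\<in>tail. 2 * (\<mu> j)\<^sup>2 + 2 * (\<Sum>i<n. (res j i)\<^sup>2))"
    unfolding sum_distrib_left by (intro sum_mono) (auto simp: tail_def)
  also have "\<dots> = 2 * (\<Sum>j\<in>tail. (\<mu> j)\<^sup>2) + 2 * (\<Sum>j\<in>tail. \<Sum>i<n. (res j i)\<^sup>2)"
    by (simp add: sum.distrib sum_distrib_left)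
  also have "(\<Sum>j\<in>tail. \<Sum>i<n. (res j i)\<^sup>2) \<le> (\<Sum>j<n. \<Sum>i<n. (res j i)\<^sup>2)"
    using tail_subset by (intro sum_mono2) (auto intro: sum_nonneg)
  finally show ?thesis using tail_eigenvalues_le sum_res_square by simp
qed

end

subsection \<open>Double centering\<close>

lemma centering_commute: "centering n i j = centering n j i"
  by (auto simp: centering_def)

lemma sum_centering:
  assumes "i < n"
  shows "(\<Sum>k<n. centering n i k * f k) = f i - (\<Sum>k<n. f k) / real n"
proof -
  have "(\<Sum>k<n. centering n i k * f k) = (\<Sum>k<n. (if i = k then f k else 0) - f k / real n)"
    by (intro sum.cong refl) (auto simp: centering_def algebra_simps)
  then show ?thesis using assms by (simp add: sum_subtractf sum_divide_distrib)
qed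

lemma sum_centering_eq_0:
  assumes "i < n"
  shows "(\<Sum>k<n. centering n i k) = 0" "(\<Sum>k<n. centering n k i) = 0"
  using sum_centering[OF assms, of "\<lambda>_. 1"] assms by (simp_all add: centering_commute[of n _ i])

lemma centered_eq_sum_centering:
  assumes "i < n"
  shows "centered n x i = (\<Sum>k<n. centering n i k *\<^sub>R x k)"
proof -
  have "(\<Sum>k<n. centering n i k *\<^sub>R x k) = (\<Sum>k<n. (if i = k then x k else 0) - (1 / real n) *\<^sub>R x k)"
    by (intro sum.cong refl) (auto simp: centering_def algebra_simps)
  then show ?thesis using assms by (simp add: sum_subtractf centered_def scaleR_sum_right)
qed

text \<open>The variance identity: removing the mean \<open>m\<close> lowers the sum of squares by
  \<open>real n * m\<^sup>2\<close>.\<close>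

lemma centering_contraction:
  "(\<Sum>i<n. (\<Sum>k<n. centering n i k * f k)\<^sup>2) \<le> (\<Sum>k<n. (f k)\<^sup>2)"
proof (cases "n = 0")
  case False
  define m where "m = (\<Sum>k<n. f k) / real n"
  have "(\<Sum>i<n. (\<Sum>k<n. centering n i k * f k)\<^sup>2) = (\<Sum>i<n. (f i - m)\<^sup>2)"
    by (simp add: sum_centering m_def)
  also have "\<dots> = (\<Sum>i<n. (f i)\<^sup>2) - 2 * m * (\<Sum>i<n. f i) + real n * m\<^sup>2"
    by (simp add: power2_diff sum.distrib sum_subtractf sum_distrib_left mult_ac)
  also have "\<dots> = (\<Sum>i<n. (f i)\<^sup>2) - real n * m\<^sup>2"
    using False by (simp add: m_def power2_eq_square)
  finally show ?thesis by simp
qed simp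

lemma double_centering_contraction:
  "(\<Sum>i<n. \<Sum>j<n. (\<Sum>k<n. \<Sum>l<n. centering n i k * F k l * centering n l j)\<^sup>2) \<le> (\<Sum>k<n. \<Sum>l<n. (F k l)\<^sup>2)"
proof -
  have eq: "(\<Sum>k<n. \<Sum>l<n. centering n i k * F k l * centering n l j)
      = (\<Sum>k<n. centering n i k * (\<Sum>l<n. centering n j l * F k l))" for i j
    by (simp add: sum_distrib_left mult_ac centering_commute[of n _ j])
  have "(\<Sum>i<n. \<Sum>j<n. (\<Sum>k<n. \<Sum>l<n. centering n i k * F k l * centering n l j)\<^sup>2)
      = (\<Sum>j<n. \<Sum>i<n. (\<Sum>k<n. centering n i k * (\<Sum>l<n. centering n j l * F k l))\<^sup>2)"
    unfolding eq by (rule sum.swap)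
  also have "\<dots> \<le> (\<Sum>j<n. \<Sum>k<n. (\<Sum>l<n. centering n j l * F k l)\<^sup>2)"
    by (intro sum_mono centering_contraction)
  also have "\<dots> = (\<Sum>k<n. \<Sum>j<n. (\<Sum>l<n. centering n j l * F k l)\<^sup>2)"
    by (rule sum.swap)
  also have "\<dots> \<le> (\<Sum>k<n. \<Sum>l<n. (F k l)\<^sup>2)"
    by (intro sum_mono centering_contraction)
  finally show ?thesis .
qed

text \<open>The identity behind classical multidimensional scaling: in the expansion of the squared
  distance the two squared norms depend on one index only and are annihilated by centering in the
  other.\<close>

lemma gram_eq_double_centering:
  fixes x :: "nat \<Rightarrow> real^'d"
  assumes i: "i < n" and j: "j < n"
  shows "centered n x i \<bullet> centered n x j
    = - (1/2) * (\<Sum>k<n. \<Sum>l<n. centering n i k * (dist (x k) (x l))\<^sup>2 * centering n l j)"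
proof -
  have d: "(dist (x k) (x l))\<^sup>2 = x k \<bullet> x k + x l \<bullet> x l - 2 * (x k \<bullet> x l)" for k l
    by (simp add: dist_norm power2_norm_eq_inner inner_diff_left inner_diff_right inner_commute)
  have s1: "(\<Sum>k<n. \<Sum>l<n. centering n i k * (x k \<bullet> x k) * centering n l j) = 0"
    by (simp add: sum_distrib_left[symmetric] sum_centering_eq_0[OF j])
  have s2: "(\<Sum>k<n. \<Sum>l<n. centering n i k * (x l \<bullet> x l) * centering n l j) = 0"
    by (subst sum.swap) (simp add: sum_distrib_right[symmetric] sum_centering_eq_0[OF i])
  have s3: "(\<Sum>k<n. \<Sum>l<n. centering n i k * (x k \<bullet> x l) * centering n l j)
      = centered n x i \<bullet> centered n x j"
    unfolding centered_eq_sum_centering[OF i] centered_eq_sum_centering[OF j] inner_sum_left inner_sum_right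
    by (subst sum.swap) (simp add: mult_ac centering_commute[of n _ j])
  have split: "centering n i k * (dist (x k) (x l))\<^sup>2 * centering n l j
     = centering n i k * (x k \<bullet> x k) * centering n l j + centering n i k * (x l \<bullet> x l) * centering n l j
     - 2 * (centering n i k * (x k \<bullet> x l) * centering n l j)" for k l
    unfolding d by (simp add: algebra_simps)
  have "(\<Sum>k<n. \<Sum>l<n. centering n i k * (dist (x k) (x l))\<^sup>2 * centering n l j)
     = (\<Sum>k<n. \<Sum>l<n. centering n i k * (x k \<bullet> x k) * centering n l j)
     + (\<Sum>k<n. \<Sum>l<n. centering n i k * (x l \<bullet> x l) * centering n l j)
     - 2 * (\<Sum>k<n. \<Sum>l<n. centering n i k * (x k \<bullet> x l) * centering n l j)"
    unfolding split sum_subtractf sum.distrib by (simp only: sum_distrib_left)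
  then show ?thesis unfolding s1 s2 s3 by simp
qed

text \<open>This serves to show that the output of MDS-MAP is already centered.\<close>

lemma mds_gram_column_sum:
  assumes "j < n"
  shows "(\<Sum>i<n. mds_gram n R E i j) = 0"
proof -
  have "(\<Sum>i<n. \<Sum>k<n. \<Sum>l<n. centering n i k * Dhat n R E k l * centering n l j)
      = (\<Sum>k<n. \<Sum>i<n. \<Sum>l<n. centering n i k * Dhat n R E k l * centering n l j)" by (rule sum.swap)
  also have "\<dots> = (\<Sum>k<n. \<Sum>l<n. \<Sum>i<n. centering n i k * Dhat n R E k l * centering n l j)"
    by (intro sum.cong refl sum.swap)
  also have "\<dots> = 0"
    by (simp add: sum_distrib_right[symmetric] sum_centering_eq_0)
  finally show ?thesis unfolding mds_gram_def sum_distrib_left[symmetric] by simp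
qed

section \<open>MDS-MAP outputs from approximate squared distances\<close>

text \<open>The witness \<open>S\<close> turns the output into the orthogonal projection of the
  columns of \<open>L X\<close> onto the eigenvectors kept, so the remaining error lives on
  \<open>tail\<close>, where the perturbation bound applies.\<close>

lemma mds_output_approximation:
  fixes x Xh :: "nat \<Rightarrow> real^'d"
  assumes out: "mds_output n (mds_gram n R E) Xh"
    and d_le: "CARD('d) \<le> n" and \<sigma>: "0 < \<sigma>"
    and moment: "\<And>w. \<sigma> * (w \<bullet> w) \<le> (\<Sum>i<n. (centered n x i \<bullet> w)\<^sup>2)"
    and dist_err: "\<And>k l. k < n \<Longrightarrow> l < n \<Longrightarrow> \<bar>Dhat n R E k l - (dist (x k) (x l))\<^sup>2\<bar> \<le> \<tau>"
  shows "\<exists>S. \<sigma> * (frob_dev n x Xh S)\<^sup>2 \<le> (real n * \<tau>)\<^sup>2"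
proof -
  define M where "M = mds_gram n R E"
  define y where "y = centered n x"
  obtain V \<mu> and e :: "'d \<Rightarrow> nat" where
    orth: "\<forall>j<n. \<forall>j'<n. (\<Sum>i<n. V j i * V j' i) = (if j = j' then 1 else 0)" and
    eig: "\<forall>j<n. \<forall>i<n. (\<Sum>l<n. M i l * V j l) = \<mu> j * V j i" and
    dec: "\<forall>j j'. j \<le> j' \<and> j' < n \<longrightarrow> \<mu> j' \<le> \<mu> j" and
    e: "bij_betw e UNIV {..<CARD('d)}" and
    Xh: "\<forall>i<n. Xh i = (\<chi> k. V (e k) i * sqrt (max 0 (\<mu> (e k))))"
    using out[unfolded mds_output_def, folded M_def] by (elim exE conjE)
  interpret gram_perturbation n V M \<mu> y \<sigma>
    using orth eig dec d_le \<sigma> moment by unfold_locales (auto simp: y_def)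
  have e_less: "e k < n" for k
    using bij_betwE[OF e] d_le by (auto intro: less_le_trans)
  \<comment> \<open>The factor 4 cancels the square of the \<open>1/2\<close> in
    \<open>mds_gram\<close>.\<close>
  have err_le: "4 * (\<Sum>i<n. \<Sum>l<n. (err i l)\<^sup>2) \<le> (real n * \<tau>)\<^sup>2"
  proof -
    define F where "F k l = Dhat n R E k l - (dist (x k) (x l))\<^sup>2" for k l
    have "err i j = - (1/2) * (\<Sum>k<n. \<Sum>l<n. centering n i k * F k l * centering n l j)"
      if "i < n" "j < n" for i j
      unfolding err_def unfolding M_def mds_gram_def y_def gram_eq_double_centering[OF that] F_def
        right_diff_distrib left_diff_distrib sum_subtractf by simp
    then have "4 * (\<Sum>i<n. \<Sum>l<n. (err i l)\<^sup>2)
      = (\<Sum>i<n. \<Sum>j<n. (\<Sum>k<n. \<Sum>l<n. centering n i k * F k l * centering n l j)\<^sup>2)"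
      unfolding sum_distrib_left[of 4] by (intro sum.cong refl) (simp add: power_divide)
    also have "\<dots> \<le> (\<Sum>k<n. \<Sum>l<n. (F k l)\<^sup>2)" by (rule double_centering_contraction)
    also have "\<dots> \<le> (\<Sum>k<n. \<Sum>l<n. \<tau>\<^sup>2)"
    proof (intro sum_mono)
      fix k l assume "k \<in> {..<n}" "l \<in> {..<n}"
      then have "\<bar>F k l\<bar> \<le> \<tau>" using dist_err by (simp add: F_def)
      then show "(F k l)\<^sup>2 \<le> \<tau>\<^sup>2" by (rule power2_le_iff_abs_le[THEN iffD2, rotated]) (use \<open>\<bar>F k l\<bar> \<le> \<tau>\<close> in linarith)
    qed
    finally show ?thesis by (simp add: power2_eq_square mult_ac)
  qed
  \<comment> \<open>Summing the eigenvector equation over \<open>i\<close>: an eigenvector has mean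
    zero unless its eigenvalue is 0, and in that case its output column vanishes.\<close>
  have col_sum: "\<mu> j * (\<Sum>i<n. V j i) = 0" if "j < n" for j
  proof -
    have "\<mu> j * (\<Sum>i<n. V j i) = (\<Sum>i<n. \<Sum>l<n. M i l * V j l)"
      using eig that by (simp add: sum_distrib_left)
    also have "\<dots> = (\<Sum>l<n. (\<Sum>i<n. M i l) * V j l)"
      by (subst sum.swap) (simp add: sum_distrib_right)
    finally show ?thesis by (simp add: M_def mds_gram_column_sum)
  qed
  have Xh_centered: "centered n Xh i = Xh i" if "i < n" for i
  proof -
    have "(\<Sum>j<n. Xh j) $ k = 0" for k
    proof -
      have "(\<Sum>j<n. Xh j) $ k = (\<Sum>j<n. V (e k) j) * sqrt (max 0 (\<mu> (e k)))"
        by (simp add: Xh sum_distrib_right)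
      then show ?thesis using col_sum[OF e_less[of k]] by (auto simp: max_def)
    qed
    then have "(\<Sum>j<n. Xh j) = 0" by (simp add: vec_eq_iff)
    then show ?thesis by (simp add: centered_def)
  qed
  define H where "H = {..<n} - tail"
  have H: "H = {j. j < CARD('d) \<and> 0 < \<mu> j}" using d_le by (auto simp: H_def tail_def)
  \<comment> \<open>Dividing by \<open>sqrt (\<mu> (e l))\<close> undoes the scaling of the output
    columns; rows belonging to clipped eigenvalues, whose output columns are zero, are set to
    0.\<close>
  define S :: "real^'d^'d" where
    "S = (\<chi> l k. if 0 < \<mu> (e l) then z (e l) $ k / sqrt (\<mu> (e l)) else 0)"
  have fit: "(\<Sum>l\<in>UNIV. centered n Xh i $ l * S $ l $ k) = (\<Sum>j\<in>H. z j $ k * V j i)" if "i < n" for i k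
  proof -
    have "(\<Sum>l\<in>UNIV. centered n Xh i $ l * S $ l $ k)
        = (\<Sum>l\<in>UNIV. if 0 < \<mu> (e l) then z (e l) $ k * V (e l) i else 0)"
      using that by (intro sum.cong refl) (auto simp: Xh_centered Xh S_def)
    also have "\<dots> = (\<Sum>j<CARD('d). if 0 < \<mu> j then z j $ k * V j i else 0)"
      by (rule sum.reindex_bij_betw[OF e])
    also have "\<dots> = (\<Sum>j\<in>H. z j $ k * V j i)"
      unfolding H by (rule sum.mono_neutral_cong_right) auto
    finally show ?thesis .
  qed
  have z_comp: "z j $ k = (\<Sum>i<n. V j i * y i $ k)" for j k
    by (simp add: z_def)
  have "(frob_dev n x Xh S)\<^sup>2 = (\<Sum>i<n. \<Sum>k\<in>UNIV. (y i $ k - (\<Sum>j\<in>H. z j $ k * V j i))\<^sup>2)"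
    unfolding frob_dev_def by (subst real_sqrt_pow2) (auto simp: fit y_def intro!: sum_nonneg)
  also have "\<dots> = (\<Sum>k\<in>UNIV. \<Sum>i<n. (y i $ k - (\<Sum>j\<in>H. z j $ k * V j i))\<^sup>2)" by (rule sum.swap)
  also have "\<dots> = (\<Sum>k\<in>UNIV. \<Sum>j\<in>tail. (z j $ k)\<^sup>2)"
  proof (rule sum.cong[OF refl])
    fix k
    have "(\<Sum>i<n. (y i $ k - (\<Sum>j\<in>H. z j $ k * V j i))\<^sup>2) = (\<Sum>i<n. (y i $ k)\<^sup>2) - (\<Sum>j\<in>H. (z j $ k)\<^sup>2)"
      using residual_square_sum[of H "\<lambda>i. y i $ k"] by (simp add: H_def z_comp)
    also have "(\<Sum>i<n. (y i $ k)\<^sup>2) = (\<Sum>j<n. (z j $ k)\<^sup>2)"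
      using parseval[of "\<lambda>i. y i $ k"] by (simp add: z_comp)
    also have "\<dots> = (\<Sum>j\<in>H. (z j $ k)\<^sup>2) + (\<Sum>j\<in>tail. (z j $ k)\<^sup>2)"
      unfolding H_def using tail_subset by (intro sum.subset_diff) auto
    finally show "(\<Sum>i<n. (y i $ k - (\<Sum>j\<in>H. z j $ k * V j i))\<^sup>2) = (\<Sum>j\<in>tail. (z j $ k)\<^sup>2)" by simp
  qed
  also have "\<dots> = (\<Sum>j\<in>tail. z j \<bullet> z j)"
    by (subst sum.swap) (simp add: inner_vec_def power2_eq_square)
  finally have "\<sigma> * (frob_dev n x Xh S)\<^sup>2 \<le> (real n * \<tau>)\<^sup>2"
    using tail_component_le err_le by simp
  then show ?thesis ..
qed

subsection \<open>Hop counts\<close>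

lemma is_walk_singleton [simp]: "is_walk n E [k] \<longleftrightarrow> k < n"
  by (auto simp: is_walk_def)

lemma is_walk_Cons:
  "is_walk n E (k # l # ps) \<longleftrightarrow> k < n \<and> E k l \<and> is_walk n E (l # ps)"
  by (auto simp: is_walk_def All_less_Suc2)

lemma dist_le_walk:
  fixes x :: "nat \<Rightarrow> 'a::metric_space"
  assumes "is_walk n E ps" and "\<And>i j. E i j \<Longrightarrow> dist (x i) (x j) \<le> R"
  shows "dist (x (hd ps)) (x (last ps)) \<le> R * real (length ps - 1)"
  using assms(1)
proof (induction ps rule: induct_list012)
  case (3 k l ps)
  then have "E k l" "dist (x l) (x (last (l # ps))) \<le> R * real (length ps)"
    by (auto simp: is_walk_Cons)
  then show ?case
    using dist_triangle[of "x k" "x (last (l # ps))" "x l"] assms(2)[of k l]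
    by (simp add: algebra_simps)
qed (auto simp: is_walk_def)

lemma hop_le:
  assumes "is_walk n E ps" "hd ps = i" "last ps = j" "length ps \<le> k + 1"
  shows "hop n E i j \<le> k"
proof -
  have "length ps \<noteq> 0" using assms(1) by (auto simp: is_walk_def)
  then have "hop n E i j \<le> length ps - 1"
    unfolding hop_def using assms by (intro Least_le exI[of _ ps]) auto
  then show ?thesis using assms(4) by simp
qed

lemma dist_le_hop:
  fixes x :: "nat \<Rightarrow> 'a::metric_space"
  assumes "graph_connected n E" "i < n" "j < n" and "\<And>i j. E i j \<Longrightarrow> dist (x i) (x j) \<le> R"
  shows "dist (x i) (x j) \<le> R * real (hop n E i j)"
proof -
  obtain ps where ps: "is_walk n E ps" "hd ps = i" "last ps = j"
    using assms by (auto simp: graph_connected_def)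
  \<comment> \<open>The \<open>LEAST\<close> in \<open>hop\<close> is attained because some walk
    exists; walks are nonempty, so subtracting and adding 1 restores the length.\<close>
  then have "\<exists>qs. is_walk n E qs \<and> hd qs = i \<and> last qs = j \<and> length qs = (length ps - 1) + 1"
    by (intro exI[of _ ps]) (cases ps; auto simp: is_walk_def)
  then have "\<exists>qs. is_walk n E qs \<and> hd qs = i \<and> last qs = j \<and> length qs = hop n E i j + 1"
    unfolding hop_def by (rule LeastI)
  then obtain qs where qs: "is_walk n E qs" "hd qs = i" "last qs = j" "length qs = hop n E i j + 1"
    by blast
  show ?thesis using dist_le_walk[of n E qs x R] qs assms(4) by simp
qed

text \<open>Each greedy step gains \<open>\<rho>\<close>, and after at most \<open>t\<close> of them
  the destination is within \<open>R\<close>. Closeness does not guarantee an edge, so the walk ends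
  with two hops through a common neighbour. A list of \<open>t + 3\<close> nodes means
  \<open>t + 2\<close> hops.\<close>

lemma greedy_walk_exists:
  fixes x :: "nat \<Rightarrow> 'a::metric_space"
  assumes step: "\<And>k j. k < n \<Longrightarrow> j < n \<Longrightarrow> R < dist (x k) (x j) \<Longrightarrow>
      \<exists>m<n. E k m \<and> dist (x m) (x j) \<le> dist (x k) (x j) - \<rho>"
    and common: "\<And>k j. k < n \<Longrightarrow> j < n \<Longrightarrow> k \<noteq> j \<Longrightarrow> dist (x k) (x j) \<le> R \<Longrightarrow>
      \<exists>m<n. E k m \<and> E m j"
    and "k < n" "j < n" "dist (x k) (x j) \<le> R + real t * \<rho>"
  shows "\<exists>ps. is_walk n E ps \<and> hd ps = k \<and> last ps = j \<and> length ps \<le> t + 3"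
proof -
  have near: "\<exists>ps. is_walk n E ps \<and> hd ps = k \<and> last ps = j \<and> length ps \<le> 3"
    if kj: "k < n" "j < n" "dist (x k) (x j) \<le> R" for k j
  proof (cases "k = j")
    case True
    then show ?thesis using kj by (intro exI[of _ "[k]"]) auto
  next
    case False
    then obtain m where "m < n" "E k m" "E m j" using common kj by blast
    then show ?thesis using kj by (intro exI[of _ "[k, m, j]"]) (auto simp: is_walk_Cons)
  qed
  show ?thesis
    using assms(3,5)
  proof (induction t arbitrary: k)
    case 0
    then show ?case using near[of k j] \<open>j < n\<close> by auto
  next
    case (Suc t)
    show ?case
    proof (cases "dist (x k) (x j) \<le> R")
      case True
      then obtain ps where "is_walk n E ps" "hd ps = k" "last ps = j" "length ps \<le> 3"
        using near[of k j] Suc.prems \<open>j < n\<close> by blast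
      then show ?thesis by (intro exI[of _ ps]) auto
    next
      case False
      then obtain m where m: "m < n" "E k m" "dist (x m) (x j) \<le> dist (x k) (x j) - \<rho>"
        using step[of k j] Suc.prems \<open>j < n\<close> by auto
      then have "dist (x m) (x j) \<le> R + real t * \<rho>"
        using Suc.prems by (simp add: algebra_simps)
      then obtain ps where ps: "is_walk n E ps" "hd ps = m" "last ps = j" "length ps \<le> t + 3"
        using Suc.IH[OF m(1)] by blast
      then obtain qs where "ps = m # qs" by (cases ps) (auto simp: is_walk_def)
      then show ?thesis using ps m Suc.prems
        by (intro exI[of _ "k # ps"]) (auto simp: is_walk_Cons)
    qed
  qed
qed

lemma hop_distance_bounds:
  fixes x :: "nat \<Rightarrow> 'a::metric_space"
  assumes step: "\<And>k j. k < n \<Longrightarrow> j < n \<Longrightarrow> R < dist (x k) (x j) \<Longrightarrow>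
      \<exists>m<n. E k m \<and> dist (x m) (x j) \<le> dist (x k) (x j) - \<rho>"
    and common: "\<And>k j. k < n \<Longrightarrow> j < n \<Longrightarrow> k \<noteq> j \<Longrightarrow> dist (x k) (x j) \<le> R \<Longrightarrow>
      \<exists>m<n. E k m \<and> E m j"
    and edge_le: "\<And>i j. E i j \<Longrightarrow> dist (x i) (x j) \<le> R"
    and \<rho>: "0 < \<rho>" "\<rho> \<le> R"
  shows "graph_connected n E"
    and "\<And>k j. k < n \<Longrightarrow> j < n \<Longrightarrow> dist (x k) (x j) \<le> R * real (hop n E k j)"
    and "\<And>k j. k < n \<Longrightarrow> j < n \<Longrightarrow> R * real (hop n E k j) \<le> (R / \<rho>) * dist (x k) (x j) + 2 * R"
proof -
  define t where "t k j = nat \<lceil>(dist (x k) (x j) - R) / \<rho>\<rceil>" for k j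
  have walk: "\<exists>ps. is_walk n E ps \<and> hd ps = k \<and> last ps = j \<and> length ps \<le> t k j + 3"
    if "k < n" "j < n" for k j
  proof (rule greedy_walk_exists[of n R x E \<rho>])
    have "(dist (x k) (x j) - R) / \<rho> \<le> real (t k j)" unfolding t_def by linarith
    then show "dist (x k) (x j) \<le> R + real (t k j) * \<rho>" using \<rho> by (simp add: field_simps)
  qed (use step common that in auto)
  then show con: "graph_connected n E" unfolding graph_connected_def by blast
  show "dist (x k) (x j) \<le> R * real (hop n E k j)" if "k < n" "j < n" for k j
    using dist_le_hop[OF con that edge_le] .
  show "R * real (hop n E k j) \<le> (R / \<rho>) * dist (x k) (x j) + 2 * R" if kj: "k < n" "j < n" for k j
  proof -
    obtain ps where ps: "is_walk n E ps" "hd ps = k" "last ps = j" "length ps \<le> t k j + 3"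
      using walk[OF kj] by blast
    have "hop n E k j \<le> t k j + 2"
      by (rule hop_le[OF ps(1-3)]) (use ps(4) in simp)
    then have h: "real (hop n E k j) \<le> real (t k j) + 2" by linarith
    have "real (t k j) \<le> dist (x k) (x j) / \<rho>"
    proof (cases "dist (x k) (x j) \<le> R")
      case True
      then have "(dist (x k) (x j) - R) / \<rho> \<le> 0" using \<rho> by (simp add: divide_nonpos_pos)
      then have "t k j = 0" unfolding t_def by simp
      then show ?thesis using \<rho> by simp
    next
      case False
      then have "0 \<le> (dist (x k) (x j) - R) / \<rho>" using \<rho> by simp
      then have "real (t k j) \<le> (dist (x k) (x j) - R) / \<rho> + 1" unfolding t_def by linarith
      \<comment> \<open>The rounding loss of 1 is absorbed by \<open>R / \<rho>\<close>, which is at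
        least 1.\<close>
      also have "\<dots> \<le> dist (x k) (x j) / \<rho>" using \<rho> by (simp add: field_simps)
      finally show ?thesis .
    qed
    then have "real (hop n E k j) \<le> dist (x k) (x j) / \<rho> + 2" using h by linarith
    then have "R * real (hop n E k j) \<le> R * (dist (x k) (x j) / \<rho> + 2)"
      using \<rho> by (intro mult_left_mono) auto
    then show ?thesis by (simp add: algebra_simps)
  qed
qed

subsection \<open>Points in the unit cube\<close>

text \<open>The image of the unit cube under the homothety with centre \<open>y\<close> and ratio \<open>s\<close>; unlike a cube
  centred at \<open>y\<close> it stays inside the unit cube, even for \<open>y\<close> on the boundary.\<close>
definition subcube :: "real^'d::finite \<Rightarrow> real \<Rightarrow> (real^'d) set" where
  "subcube y s = cbox ((1 - s) *\<^sub>R y) ((1 - s) *\<^sub>R y + s *\<^sub>R One)"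

lemma One_nth [simp]: "(One :: real^'d::finite) $ k = 1"
  unfolding cart_eq_inner_axis by (rule inner_sum_Basis) simp

lemma mem_unit_cube: "(x::real^'d::finite) \<in> cbox 0 One \<longleftrightarrow> (\<forall>k. 0 \<le> x $ k \<and> x $ k \<le> 1)"
  by (simp add: mem_box_cart del: sum_component)

lemma mem_subcube:
  "z \<in> subcube y s \<longleftrightarrow> (\<forall>k. (1 - s) * y $ k \<le> z $ k \<and> z $ k \<le> (1 - s) * y $ k + s)"
  by (simp add: subcube_def mem_box_cart del: sum_component)

lemma subcube_subset:
  assumes y: "y \<in> cbox 0 One" and s: "0 \<le> s" "s \<le> 1"
  shows "subcube y s \<subseteq> cbox 0 One"
proof
  fix z assume "z \<in> subcube y s"
  then have z: "(1 - s) * y $ k \<le> z $ k" "z $ k \<le> (1 - s) * y $ k + s" for k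
    by (auto simp: mem_subcube)
  have y': "0 \<le> y $ k" "y $ k \<le> 1" for k using y by (auto simp: mem_unit_cube)
  have "0 \<le> z $ k \<and> z $ k \<le> 1" for k
  proof
    show "0 \<le> z $ k" using z(1)[of k] y'(1)[of k] s by (smt (verit) mult_nonneg_nonneg)
    have "(1 - s) * y $ k \<le> (1 - s) * 1" using y'[of k] s by (intro mult_left_mono) auto
    then show "z $ k \<le> 1" using z(2)[of k] by simp
  qed
  then show "z \<in> cbox 0 One" by (simp add: mem_unit_cube)
qed

text \<open>The point \<open>y\<close> lies in its own subcube, so each coordinate differs by at
  most the side \<open>s\<close>.\<close>

lemma dist_subcube_le:
  fixes y z :: "real^'d"
  assumes y: "y \<in> cbox 0 One" and s: "0 \<le> s" and z: "z \<in> subcube y s"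
  shows "dist y z \<le> s * sqrt (real CARD('d))"
proof -
  have "(dist y z)\<^sup>2 = (\<Sum>k\<in>UNIV. (y $ k - z $ k)\<^sup>2)"
    unfolding dist_norm power2_norm_eq_inner by (simp add: inner_vec_def power2_eq_square)
  also have "\<dots> \<le> (\<Sum>k\<in>(UNIV::'d set). s\<^sup>2)"
  proof (intro sum_mono)
    fix k
    have "(1 - s) * y $ k \<le> z $ k" "z $ k \<le> (1 - s) * y $ k + s" using z by (auto simp: mem_subcube)
    moreover have "0 \<le> s * y $ k" "s * y $ k \<le> s * 1"
      using y s mult_left_mono[of "y $ k" 1 s] by (auto simp: mem_unit_cube)
    ultimately have "\<bar>y $ k - z $ k\<bar> \<le> s" by (simp add: algebra_simps abs_le_iff)
    then show "(y $ k - z $ k)\<^sup>2 \<le> s\<^sup>2" using abs_le_square_iff[of "y $ k - z $ k" s] s by simp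
  qed
  also have "\<dots> = (s * sqrt (real CARD('d)))\<^sup>2" by (simp add: power_mult_distrib)
  finally show ?thesis using s by (simp add: power2_le_iff_abs_le)
qed

text \<open>The point at distance \<open>r\<close> from \<open>p\<close> on the segment towards
  \<open>q\<close>. The cap at 1 yields \<open>q\<close> when \<open>q\<close> is nearer than that,
  and division by zero yields \<open>p\<close> when the points coincide; thus it never leaves the
  segment for nonnegative \<open>r\<close>.\<close>

definition target :: "real \<Rightarrow> 'a::real_normed_vector \<Rightarrow> 'a \<Rightarrow> 'a" where
  "target r p q = p + min 1 (r / dist p q) *\<^sub>R (q - p)"

lemma target_in_convex:
  assumes "convex C" "p \<in> C" "q \<in> C" "0 \<le> r"
  shows "target r p q \<in> C"
proof -
  define u where "u = min 1 (r / dist p q)"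
  have "0 \<le> u" "u \<le> 1" using assms by (auto simp: u_def)
  then have "(1 - u) *\<^sub>R p + u *\<^sub>R q \<in> C" using assms by (simp add: convex_alt)
  then show ?thesis by (simp add: target_def u_def[symmetric] algebra_simps)
qed

lemma dist_target:
  assumes "0 < dist p q" "0 \<le> r" "r \<le> dist p q"
  shows "dist p (target r p q) = r" "dist (target r p q) q = dist p q - r"
proof -
  define u where "u = r / dist p q"
  have u: "0 \<le> u" "u \<le> 1" using assms by (auto simp: u_def)
  then have t: "target r p q = p + u *\<^sub>R (q - p)" by (simp add: target_def u_def min_def)
  have "dist p (target r p q) = u * dist p q"
    using u by (simp add: t dist_norm norm_minus_commute)
  then show "dist p (target r p q) = r" using assms by (simp add: u_def)
  have "target r p q - q = (1 - u) *\<^sub>R (p - q)" by (simp add: t algebra_simps)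
  then have "dist (target r p q) q = (1 - u) * dist p q" using u by (simp add: dist_norm)
  then show "dist (target r p q) q = dist p q - r" using assms by (simp add: u_def field_simps)
qed

text \<open>The key under which \<open>edge\<close> looks up the auxiliary variable of an unordered
  pair.\<close>

definition pair :: "nat \<Rightarrow> nat \<Rightarrow> nat \<times> nat" where "pair i j = (min i j, max i j)"

text \<open>For \<open>0 < dist\<close> only: since \<open>0 powr (- \<beta>) = 0\<close>, coinciding points are never joined.\<close>
lemma edgeI:
  assumes "i \<noteq> j" "0 < dist (x i) (x j)" "dist (x i) (x j) \<le> R" "U (pair i j) < \<alpha>"
    and "0 \<le> \<beta>" "0 < \<alpha>" "\<alpha> \<le> 1"
  shows "edge \<alpha> \<beta> R x U i j"
proof -
  have "0 < R" using assms by linarith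
  then have "dist (x i) (x j) / R \<le> 1" using assms(3) by (simp add: divide_le_eq_1)
  then have "1 \<le> (dist (x i) (x j) / R) powr (- \<beta>)"
    using assms \<open>0 < R\<close> by (subst powr_minus) (auto simp: one_le_inverse_iff intro!: powr_le1)
  then have "\<alpha> \<le> detect \<alpha> \<beta> R (dist (x i) (x j))"
    using assms by (auto simp: detect_def)
  then show ?thesis using assms by (auto simp: edge_def pair_def)
qed

lemma edge_commute: "edge \<alpha> \<beta> R x U i j = edge \<alpha> \<beta> R x U j i"
  by (auto simp: edge_def dist_commute min.commute max.commute)

section \<open>Deviation bounds and the sample covariance\<close>

lemma frob_dev_nonneg: "0 \<le> frob_dev n X Xh S"
  by (simp add: frob_dev_def sum_nonneg)

lemma INF_frob_dev_le: "(INF S. frob_dev n X Xh S) \<le> frob_dev n X Xh S"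
  by (rule cINF_lower) (auto intro!: bdd_belowI[of _ 0] simp: frob_dev_nonneg)

text \<open>\<open>S = 0\<close> leaves the centered positions, and centering contracts each
  coordinate column.\<close>

lemma frob_dev_0_le:
  fixes x :: "nat \<Rightarrow> real^'d"
  assumes x: "\<And>i. i < n \<Longrightarrow> x i \<in> cbox 0 One"
  shows "(frob_dev n x Xh 0)\<^sup>2 \<le> real n * real CARD('d)"
proof -
  have "(frob_dev n x Xh 0)\<^sup>2 = (\<Sum>k\<in>UNIV. \<Sum>i<n. (centered n x i $ k)\<^sup>2)"
    unfolding frob_dev_def by (subst sum.swap) (simp add: sum_nonneg)
  also have "\<dots> = (\<Sum>k\<in>UNIV. \<Sum>i<n. (\<Sum>l<n. centering n i l * x l $ k)\<^sup>2)"
    by (simp add: centered_eq_sum_centering)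
  also have "\<dots> \<le> (\<Sum>k\<in>UNIV. \<Sum>i<n. (x i $ k)\<^sup>2)"
    by (intro sum_mono centering_contraction)
  also have "\<dots> \<le> (\<Sum>k\<in>(UNIV::'d set). \<Sum>i<n. 1)"
    using x by (intro sum_mono) (auto simp: mem_unit_cube power_le_one)
  finally show ?thesis by (simp add: mult.commute)
qed

text \<open>Each entry of the sample covariance is within \<open>1/72\<close> of \<open>1/12\<close>
  times the identity. By Cauchy-Schwarz in dimension at most 3 this perturbs the quadratic form by
  at most \<open>3/72 = 1/24\<close> times \<open>w \<bullet> w\<close>, and
  \<open>1/12 - 1/24 = 1/24\<close> remains.\<close>

lemma centered_moment_ge:
  fixes x :: "nat \<Rightarrow> real^'d"
  assumes n: "0 < n" and d: "CARD('d) \<le> 3"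
    and mean1: "\<And>a. \<bar>(\<Sum>i<n. x i $ a) - real n / 2\<bar> \<le> real n / 150"
    and mean2: "\<And>a b. \<bar>(\<Sum>i<n. x i $ a * x i $ b) - real n * (if a = b then 1/3 else 1/4)\<bar> \<le> real n / 150"
  shows "real n / 24 * (w \<bullet> w) \<le> (\<Sum>i<n. (centered n x i \<bullet> w)\<^sup>2)"
proof -
  define m where "m a = (\<Sum>i<n. x i $ a) / real n" for a
  define c where "c a b = (\<Sum>i<n. x i $ a * x i $ b) / real n - m a * m b" for a b
  have m: "\<bar>m a - 1/2\<bar> \<le> 1/150" for a
    using mean1[of a] n by (simp add: m_def abs_le_iff field_simps)
  have c: "\<bar>c a b - (if a = b then 1/12 else 0)\<bar> \<le> 1/72" for a b
  proof -
    \<comment> \<open>The second-order part of the error in the product of the means; the total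
      error is at most \<open>2/150 + 1/22500\<close>, just below \<open>1/72\<close>.\<close>
    define P where "P = (m a - 1/2) * (m b - 1/2)"
    have "\<bar>P\<bar> \<le> 1/150 * (1/150)"
      unfolding P_def abs_mult using m[of a] m[of b] by (intro mult_mono) auto
    then have "\<bar>P\<bar> \<le> 1/22500" by simp
    moreover have "m a * m b = P + (m a - 1/2) / 2 + (m b - 1/2) / 2 + 1/4"
      by (simp add: P_def field_simps)
    moreover have "\<bar>(\<Sum>i<n. x i $ a * x i $ b) / real n - (if a = b then 1/3 else 1/4)\<bar> \<le> 1/150"
      using mean2[of a b] n by (auto simp: abs_le_iff field_simps split: if_splits)
    moreover have "(if a = b then 1/12 else 0 :: real) = (if a = b then 1/3 else 1/4) - 1/4" by simp
    moreover have "\<bar>q - w - e'\<bar> \<le> 1/72"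
      if "\<bar>P\<bar> \<le> 1/22500" "w = P + (u - 1/2) / 2 + (v - 1/2) / 2 + 1/4" "\<bar>q - e\<bar> \<le> 1/150"
        "e' = e - 1/4" "\<bar>u - 1/2\<bar> \<le> 1/150" "\<bar>v - 1/2\<bar> \<le> 1/150" for P q w e e' u v :: real
      using that by argo
    ultimately show ?thesis using m[of a] m[of b] unfolding c_def by blast
  qed
  have cov: "(\<Sum>i<n. centered n x i $ a * centered n x i $ b) = real n * c a b" for a b
  proof -
    have "centered n x i $ a = x i $ a - m a" for i a by (simp add: centered_def m_def)
    then have "(\<Sum>i<n. centered n x i $ a * centered n x i $ b)
       = (\<Sum>i<n. x i $ a * x i $ b) - m b * (\<Sum>i<n. x i $ a) - m a * (\<Sum>i<n. x i $ b) + real n * (m a * m b)"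
      by (simp add: left_diff_distrib right_diff_distrib sum_subtractf sum.distrib sum_distrib_left mult_ac)
    also have "(\<Sum>i<n. x i $ a) = real n * m a" using n by (simp add: m_def)
    also have "(\<Sum>i<n. x i $ b) = real n * m b" using n by (simp add: m_def)
    finally show ?thesis using n by (simp add: c_def right_diff_distrib mult_ac)
  qed
  have "(\<Sum>i<n. (centered n x i \<bullet> w)\<^sup>2)
      = (\<Sum>i<n. \<Sum>a\<in>UNIV. \<Sum>b\<in>UNIV. w $ a * w $ b * (centered n x i $ a * centered n x i $ b))"
    by (simp add: inner_vec_def power2_eq_square sum_product mult_ac)
  also have "\<dots> = (\<Sum>a\<in>UNIV. \<Sum>i<n. \<Sum>b\<in>UNIV. w $ a * w $ b * (centered n x i $ a * centered n x i $ b))"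
    by (rule sum.swap)
  also have "\<dots> = (\<Sum>a\<in>UNIV. \<Sum>b\<in>UNIV. \<Sum>i<n. w $ a * w $ b * (centered n x i $ a * centered n x i $ b))"
    by (intro sum.cong refl sum.swap)
  also have "\<dots> = (\<Sum>a\<in>UNIV. \<Sum>b\<in>UNIV. w $ a * w $ b * (real n * c a b))"
    unfolding sum_distrib_left[symmetric] cov ..
  also have "\<dots> = real n * (\<Sum>a\<in>UNIV. \<Sum>b\<in>UNIV. w $ a * w $ b * c a b)"
    by (simp add: sum_distrib_left mult_ac)
  finally have eq: "(\<Sum>i<n. (centered n x i \<bullet> w)\<^sup>2) = real n * (\<Sum>a\<in>UNIV. \<Sum>b\<in>UNIV. w $ a * w $ b * c a b)" .
  have "(\<Sum>a\<in>UNIV. \<Sum>b\<in>UNIV. (if a = b then (w $ a)\<^sup>2 / 12 else 0) - \<bar>w $ a\<bar> * \<bar>w $ b\<bar> / 72)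
      \<le> (\<Sum>a\<in>UNIV. \<Sum>b\<in>UNIV. w $ a * w $ b * c a b)"
  proof (intro sum_mono)
    fix a b :: 'd
    define \<delta> where "\<delta> = c a b - (if a = b then 1/12 else 0)"
    have "\<bar>w $ a * w $ b * \<delta>\<bar> \<le> \<bar>w $ a\<bar> * \<bar>w $ b\<bar> * (1/72)"
      unfolding abs_mult using c[of a b] by (intro mult_left_mono) (auto simp: \<delta>_def)
    moreover have "w $ a * w $ b * c a b = w $ a * w $ b * \<delta> + (if a = b then (w $ a)\<^sup>2 / 12 else 0)"
      by (auto simp: \<delta>_def algebra_simps power2_eq_square)
    ultimately show "(if a = b then (w $ a)\<^sup>2 / 12 else 0) - \<bar>w $ a\<bar> * \<bar>w $ b\<bar> / 72 \<le> w $ a * w $ b * c a b"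
      by (simp add: abs_le_iff)
  qed
  moreover have "(\<Sum>a\<in>UNIV. \<Sum>b\<in>UNIV. (if a = b then (w $ a)\<^sup>2 / 12 else 0) - \<bar>w $ a\<bar> * \<bar>w $ b\<bar> / 72)
      = (w \<bullet> w) / 12 - (\<Sum>a\<in>UNIV. \<bar>w $ a\<bar>)\<^sup>2 / 72"
    by (simp add: sum_subtractf inner_vec_def power2_eq_square sum_product sum_divide_distrib)
  moreover have "(\<Sum>a\<in>UNIV. \<bar>w $ a\<bar>)\<^sup>2 \<le> 3 * (w \<bullet> w)"
  proof -
    have "(\<Sum>a\<in>UNIV. \<bar>w $ a\<bar>)\<^sup>2 \<le> real CARD('d) * (\<Sum>a\<in>UNIV. \<bar>w $ a\<bar>\<^sup>2)"
      using Cauchy_Schwarz_ineq_sum[of "\<lambda>_. 1" "\<lambda>a. \<bar>w $ a\<bar>" UNIV] by simp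
    also have "\<dots> = real CARD('d) * (w \<bullet> w)" by (simp add: inner_vec_def power2_eq_square)
    also have "\<dots> \<le> 3 * (w \<bullet> w)" using d by (intro mult_right_mono) auto
    finally show ?thesis .
  qed
  ultimately have "(w \<bullet> w) / 24 \<le> (\<Sum>a\<in>UNIV. \<Sum>b\<in>UNIV. w $ a * w $ b * c a b)" by linarith
  then show ?thesis unfolding eq using n by (simp add: field_simps)
qed

section \<open>Deterministic conditions for the good event\<close>

text \<open>A common form of the two link conditions, so that one probability estimate serves both:
  \<open>W\<close> is the region for the intermediate node, \<open>K\<close> the set of pairs whose
  variables must fall below \<open>\<alpha>\<close>.\<close>

definition all_linked ::
  "nat \<Rightarrow> real \<Rightarrow> ('a \<Rightarrow> 'a \<Rightarrow> 'a \<Rightarrow> bool) \<Rightarrow> (nat \<Rightarrow> nat \<Rightarrow> nat \<Rightarrow> (nat \<times> nat) set) \<Rightarrow>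
    (nat \<Rightarrow> 'a) \<Rightarrow> (nat \<times> nat \<Rightarrow> real) \<Rightarrow> bool" where
  "all_linked n \<alpha> W K x U \<longleftrightarrow> (\<forall>k<n. \<forall>j<n. k \<noteq> j \<longrightarrow>
     (\<exists>m<n. m \<noteq> k \<and> m \<noteq> j \<and> W (x k) (x j) (x m) \<and> (\<forall>i\<in>K k j m. U i < \<alpha>)))"

text \<open>The points \<open>p\<close> and \<open>q\<close> are removed because
  \<open>edgeI\<close> requires positive distance; this costs no volume.\<close>

definition forward_region :: "real \<Rightarrow> real \<Rightarrow> real^'d::finite \<Rightarrow> real^'d \<Rightarrow> real^'d \<Rightarrow> bool" where
  "forward_region r s p q z \<longleftrightarrow> z \<in> subcube (target r p q) s - {p, q}"

definition middle_region :: "real \<Rightarrow> real^'d::finite \<Rightarrow> real^'d \<Rightarrow> real^'d \<Rightarrow> bool" where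
  "middle_region s p q z \<longleftrightarrow> z \<in> subcube (midpoint p q) s - {p, q}"

text \<open>Here \<open>q\<close> stands for the ratio of \<open>R_MDS\<close> to \<open>R\<close>,
  \<open>D\<close> for a true distance and \<open>D'\<close> for its hop estimate;
  \<open>17321/10000\<close> bounds the diameter \<open>sqrt 3\<close> from above.\<close>

lemma good_event_arith:
  fixes q R D D' \<rho> :: real
  assumes q: "0 \<le> q" "q \<le> 1" and R: "0 < R" "R \<le> 1/25" and D: "0 \<le> D" "D \<le> 17321/10000"
    and \<rho>: "R * (1 - 13/200 * q) \<le> \<rho>" and D': "D \<le> D'" "D' \<le> R / \<rho> * D + 2 * R"
  shows "\<bar>D'\<^sup>2 - D\<^sup>2\<bar> \<le> (q + 20 * R) / 2"
proof -
  have pos: "0 < 1 - 13/200 * q" using q by simp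
  then have "0 < \<rho>" using \<rho> R mult_pos_pos[of R "1 - 13/200 * q"] by linarith
  then have "R / \<rho> \<le> 1 / (1 - 13/200 * q)" using \<rho> pos R by (simp add: field_simps)
  also have "\<dots> \<le> 1 + 7/100 * q"
  proof -
    \<comment> \<open>The product below exceeds 1 by \<open>q/200 - 91/20000 * q\<^sup>2\<close>,
      which is nonnegative for \<open>q \<le> 1\<close>.\<close>
    have "0 \<le> q * (1 - q)" using q by simp
    then have "1 \<le> (1 + 7/100 * q) * (1 - 13/200 * q)" using q by (simp add: algebra_simps)
    then show ?thesis using pos by (simp add: divide_le_eq)
  qed
  finally have "R / \<rho> * D \<le> (1 + 7/100 * q) * D" using D by (intro mult_right_mono)
  moreover have "q * D \<le> q * (17321/10000)" using q D by (intro mult_left_mono)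
  ultimately have diff: "D' - D \<le> 1213/10000 * q + 2 * R" using D' q by (simp add: algebra_simps)
  then have sum: "D' + D \<le> (92/25)" using D q R by linarith
  \<comment> \<open>After multiplication by \<open>92/25\<close> the coefficients are below
    \<open>1/2\<close> for \<open>q\<close> and below 10 for \<open>R\<close>.\<close>
  have "(D' - D) * (D' + D) \<le> (1213/10000 * q + 2 * R) * (92/25)"
    using diff sum D D' q R by (intro mult_mono) auto
  moreover have "D'\<^sup>2 - D\<^sup>2 = (D' - D) * (D' + D)" by (simp add: power2_eq_square algebra_simps)
  moreover have "0 \<le> (D' - D) * (D' + D)" using D D' by (intro mult_nonneg_nonneg) auto
  ultimately show ?thesis using q R by (simp add: algebra_simps)
qed

text \<open>A node in the subcube around the target at distance \<open>R - h\<close> is off by at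
  most \<open>h\<close>: it stays within range \<open>R\<close> and gains at least
  \<open>R - 2 * h\<close>. A node near the midpoint of a close pair is within range of both
  ends.\<close>

lemma good_eventI:
  fixes x :: "nat \<Rightarrow> real^'d::finite"
  assumes d: "CARD('d) \<le> 3" and n: "3 \<le> n"
    and \<alpha>: "0 < \<alpha>" "\<alpha> \<le> 1" and \<beta>: "0 \<le> \<beta>"
    and r0: "0 < r0" "R_MDS \<alpha> CARD('d) n = 32 * r0"
    and s: "s = 3/5 * r0" and s': "r0 \<le> s'" "s' \<le> 1" "32 * s' < R"
    and cube: "\<And>i. i < n \<Longrightarrow> x i \<in> cbox 0 One"
    and forward: "all_linked n \<alpha> (forward_region (R - s * sqrt (real CARD('d))) s) (\<lambda>k j m. {pair k m}) x U"
    and middle: "all_linked n \<alpha> (middle_region s') (\<lambda>k j m. {pair k m, pair j m}) x U"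
    and mean1: "\<And>a. \<bar>(\<Sum>i<n. x i $ a) - real n / 2\<bar> \<le> real n / 150"
    and mean2: "\<And>a b. \<bar>(\<Sum>i<n. x i $ a * x i $ b) - real n * (if a = b then 1/3 else 1/4)\<bar> \<le> real n / 150"
  shows "good_event \<alpha> \<beta> R n (x, U)"
proof -
  define E where "E = edge \<alpha> \<beta> R x U"
  define h where "h = s * sqrt (real CARD('d))"
  define \<rho> where "\<rho> = R - 2 * h"
  define q where "q = 32 * r0 / R"
  have R: "0 < R" using r0 s' by linarith
  have q: "0 \<le> q" "q \<le> 1" using r0 s' R by (auto simp: q_def)
  have sqrt_d: "sqrt (real CARD('d)) \<le> 17321/10000"
    using d by (intro real_le_lsqrt) (auto simp: power2_eq_square)
  have h: "0 \<le> h" "h \<le> 26/25 * r0"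
  proof -
    show "0 \<le> h" using s r0 by (simp add: h_def)
    have "h \<le> s * (17321/10000)" unfolding h_def using sqrt_d s r0 by (intro mult_left_mono) auto
    then show "h \<le> 26/25 * r0" using s r0 by simp
  qed
  \<comment> \<open>From \<open>2 * h \<le> 52/25 * r0\<close>, which is \<open>13/200\<close> times
    \<open>32 * r0\<close>.\<close>
  have \<rho>: "0 < \<rho>" "\<rho> \<le> R" "R * (1 - 13/200 * q) \<le> \<rho>"
    using h r0 s' R by (auto simp: \<rho>_def q_def field_simps)
  have edge_le: "dist (x i) (x j) \<le> R" if "E i j" for i j
    using that by (simp add: E_def edge_def)
  have step: "\<exists>m<n. E k m \<and> dist (x m) (x j) \<le> dist (x k) (x j) - \<rho>"
    if kj: "k < n" "j < n" "R < dist (x k) (x j)" for k j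
  proof -
    have "k \<noteq> j" using kj R by auto
    then obtain m where m: "m < n" "m \<noteq> k" "U (pair k m) < \<alpha>"
      "x m \<in> subcube (target (R - h) (x k) (x j)) s" "x m \<noteq> x k"
      using forward kj unfolding all_linked_def forward_region_def h_def by fastforce
    define y where "y = target (R - h) (x k) (x j)"
    have Rh: "0 \<le> R - h" using \<rho> h by (simp add: \<rho>_def)
    have "y \<in> cbox 0 One" unfolding y_def using cube kj Rh by (intro target_in_convex) auto
    moreover have "0 \<le> s" using s r0 by simp
    ultimately have ym: "dist y (x m) \<le> h"
      unfolding h_def using m(4) by (intro dist_subcube_le) (auto simp: y_def)
    have y: "dist (x k) y = R - h" "dist y (x j) = dist (x k) (x j) - (R - h)"
      unfolding y_def using kj Rh R h by (auto intro!: dist_target)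
    have "dist (x k) (x m) \<le> R" using dist_triangle[of "x k" "x m" y] ym y by simp
    then have "E k m" unfolding E_def using m \<alpha> \<beta> by (intro edgeI) auto
    moreover have "dist (x m) (x j) \<le> dist (x k) (x j) - \<rho>"
      using dist_triangle[of "x m" "x j" y] ym y by (simp add: \<rho>_def dist_commute)
    ultimately show ?thesis using m by blast
  qed
  have common: "\<exists>m<n. E k m \<and> E m j"
    if kj: "k < n" "j < n" "k \<noteq> j" "dist (x k) (x j) \<le> R" for k j
  proof -
    obtain m where m: "m < n" "m \<noteq> k" "m \<noteq> j" "U (pair k m) < \<alpha>" "U (pair j m) < \<alpha>"
      "x m \<in> subcube (midpoint (x k) (x j)) s'" "x m \<noteq> x k" "x m \<noteq> x j"
      using middle kj unfolding all_linked_def middle_region_def by fastforce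
    define y where "y = midpoint (x k) (x j)"
    have "closed_segment (x k) (x j) \<subseteq> cbox 0 One" using cube kj by (intro closed_segment_subset) auto
    then have "y \<in> cbox 0 One" using midpoint_in_closed_segment[of "x k" "x j"] unfolding y_def by blast
    then have "dist y (x m) \<le> s' * sqrt (real CARD('d))"
      using m r0 s' by (intro dist_subcube_le) (auto simp: y_def)
    also have "\<dots> \<le> s' * (17321/10000)" using sqrt_d r0 s' by (intro mult_left_mono) auto
    finally have ym: "dist y (x m) \<le> R / 2" using s' r0 by linarith
    have y: "dist (x k) y \<le> R / 2" "dist (x j) y \<le> R / 2"
      using kj by (auto simp: y_def dist_midpoint)
    have "dist (x k) (x m) \<le> R" "dist (x j) (x m) \<le> R"
      using dist_triangle[of "x k" "x m" y] dist_triangle[of "x j" "x m" y] ym y by auto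
    then have "E k m" "E j m" unfolding E_def using m \<alpha> \<beta> by (auto intro!: edgeI)
    then show ?thesis using m edge_commute unfolding E_def by blast
  qed
  have connected: "graph_connected n E"
    by (rule hop_distance_bounds(1)[of n R x E \<rho>]) (fact step common edge_le \<rho>(1,2))+
  have hop_ge: "dist (x k) (x l) \<le> R * real (hop n E k l)" if "k < n" "l < n" for k l
    by (rule hop_distance_bounds(2)[of n R x E \<rho>]) (fact step common edge_le \<rho>(1,2) that)+
  have hop_le: "R * real (hop n E k l) \<le> R / \<rho> * dist (x k) (x l) + 2 * R" if "k < n" "l < n" for k l
    by (rule hop_distance_bounds(3)[of n R x E \<rho>]) (fact step common edge_le \<rho>(1,2) that)+
  have bound: "(INF S. frob_dev n x Xh S) / sqrt (real n) \<le> sqrt 6 * (q + 20 * R)"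
    if out: "mds_output n (mds_gram n R E) Xh" for Xh
  \<comment> \<open>For larger \<open>R\<close> the bound exceeds the diameter of the cube and \<open>S = 0\<close> suffices.\<close>
  proof (cases "R \<le> 1/25")
    case True
    have D: "dist (x k) (x l) \<le> 17321/10000" if "k < n" "l < n" for k l
    proof -
      have "(dist (x k) (x l))\<^sup>2 = (\<Sum>a\<in>UNIV. (x k $ a - x l $ a)\<^sup>2)"
        unfolding dist_norm power2_norm_eq_inner by (simp add: inner_vec_def power2_eq_square)
      also have "\<dots> \<le> (\<Sum>a\<in>(UNIV::'d set). 1)"
      proof (intro sum_mono)
        fix a
        have "\<bar>x k $ a - x l $ a\<bar> \<le> 1"
          using cube[OF that(1)] cube[OF that(2)] unfolding mem_unit_cube by (smt (verit))
        then show "(x k $ a - x l $ a)\<^sup>2 \<le> 1" by (simp add: abs_square_le_1)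
      qed
      finally have "dist (x k) (x l) \<le> sqrt (real CARD('d))" by (simp add: real_le_rsqrt)
      then show ?thesis using sqrt_d by linarith
    qed
    have "\<exists>S. real n / 24 * (frob_dev n x Xh S)\<^sup>2 \<le> (real n * ((q + 20 * R) / 2))\<^sup>2"
    proof (rule mds_output_approximation[OF out])
      show "CARD('d) \<le> n" "0 < real n / 24" using d n by auto
      show "real n / 24 * (w \<bullet> w) \<le> (\<Sum>i<n. (centered n x i \<bullet> w)\<^sup>2)" for w
        using n d mean1 mean2 by (intro centered_moment_ge) auto
      show "\<bar>Dhat n R E k l - (dist (x k) (x l))\<^sup>2\<bar> \<le> (q + 20 * R) / 2" if "k < n" "l < n" for k l
      proof (cases "k = l")
        case True
        then show ?thesis using q R by (simp add: Dhat_def)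
      next
        case False
        then show ?thesis
          using good_event_arith[OF q R \<open>R \<le> 1/25\<close> _ D[OF that] \<rho>(3) hop_ge[OF that] hop_le[OF that]]
          by (simp add: Dhat_def)
      qed
    qed
    then obtain S where "real n / 24 * (frob_dev n x Xh S)\<^sup>2 \<le> (real n * ((q + 20 * R) / 2))\<^sup>2" ..
    \<comment> \<open>The constant under the root arises here:
      \<open>24 * (1/2)\<^sup>2 = 6\<close>.\<close>
    then have "real n * (frob_dev n x Xh S)\<^sup>2 \<le> real n * (6 * real n * (q + 20 * R)\<^sup>2)"
      by (simp add: power_mult_distrib power_divide) (simp add: power2_eq_square algebra_simps)
    then have "(frob_dev n x Xh S)\<^sup>2 \<le> 6 * real n * (q + 20 * R)\<^sup>2" using n by simp
    also have "\<dots> = (sqrt 6 * (q + 20 * R) * sqrt (real n))\<^sup>2" by (simp add: power_mult_distrib)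
    finally have "frob_dev n x Xh S \<le> sqrt 6 * (q + 20 * R) * sqrt (real n)"
      by (rule power2_le_imp_le) (use q R in simp)
    then have "(INF S. frob_dev n x Xh S) \<le> sqrt 6 * (q + 20 * R) * sqrt (real n)"
      using INF_frob_dev_le order_trans by blast
    then show ?thesis using n by (simp add: divide_le_eq)
  next
    case False
    have "(frob_dev n x Xh 0)\<^sup>2 \<le> real n * 3"
      using frob_dev_0_le[of n x Xh] cube d mult_left_mono[of "real CARD('d)" 3 "real n"] by simp
    \<comment> \<open>\<open>96/25 = 6 * (20/25)\<^sup>2\<close> is the square of the claimed bound
      at \<open>R = 1/25\<close>, \<open>q = 0\<close>, without the factor \<open>n\<close>.\<close>
    also have "\<dots> \<le> real n * (96/25)" by simp
    also have "\<dots> = (sqrt 6 * (20 * (1/25)) * sqrt (real n))\<^sup>2" by (simp add: power_mult_distrib power2_eq_square)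
    finally have "frob_dev n x Xh 0 \<le> sqrt 6 * (20 * (1/25)) * sqrt (real n)"
      by (rule power2_le_imp_le) simp
    also have "\<dots> \<le> sqrt 6 * (q + 20 * R) * sqrt (real n)"
      using False q by (intro mult_right_mono mult_left_mono) auto
    finally have "(INF S. frob_dev n x Xh S) \<le> sqrt 6 * (q + 20 * R) * sqrt (real n)"
      using INF_frob_dev_le order_trans by blast
    then show ?thesis using n by (simp add: divide_le_eq)
  qed
  show ?thesis unfolding good_event_def Let_def fst_conv snd_conv E_def[symmetric] r0(2)
    using connected bound by (simp add: q_def)
qed

subsection \<open>Probability of missing links\<close>

text \<open>The joint distribution of the coordinates is the product measure itself, that is, the
  product of the marginals. The empty index set is treated apart, since this criterion is for
  nonempty ones.\<close>

lemma indep_vars_PiM_component: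
  assumes M: "\<And>i. i \<in> I \<Longrightarrow> prob_space (M i)"
  shows "prob_space.indep_vars (PiM I M) M (\<lambda>i \<omega>. \<omega> i) I"
proof -
  interpret P: prob_space "PiM I M" by (rule prob_space_PiM) (fact M)
  show ?thesis
  proof (cases "I = {}")
    case True
    then show ?thesis unfolding P.indep_vars_def P.indep_sets_def by simp
  next
    case False
    have "distr (PiM I M) (PiM I M) (\<lambda>\<omega>. \<lambda>i\<in>I. \<omega> i) = distr (PiM I M) (PiM I M) (\<lambda>\<omega>. \<omega>)"
      by (intro distr_cong refl) (auto simp: space_PiM PiE_restrict)
    also have "\<dots> = PiM I (\<lambda>i. distr (PiM I M) (M i) (\<lambda>\<omega>. \<omega> i))"
      using M by (auto simp: distr_PiM_component intro!: PiM_cong)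
    finally show ?thesis using False by (subst P.indep_vars_iff_distr_eq_PiM') auto
  qed
qed

text \<open>Disjoint blocks of independent coordinates are independent, and a single block lies
  entirely below \<open>\<alpha>\<close> with probability
  \<open>measure N {..<\<alpha>} ^ e\<close>.\<close>

lemma prob_no_block_below:
  fixes N :: "real measure" and I :: "'i set"
  assumes N: "prob_space N" "sets N = sets borel" and "finite L"
    and K: "\<And>m. m \<in> L \<Longrightarrow> K m \<subseteq> I" "\<And>m. m \<in> L \<Longrightarrow> finite (K m)" "\<And>m. m \<in> L \<Longrightarrow> card (K m) = e"
    and disj: "disjoint_family_on K L"
  shows "measure (PiM I (\<lambda>_. N)) {U \<in> space (PiM I (\<lambda>_. N)). \<forall>m\<in>L. \<not> (\<forall>i\<in>K m. U i < \<alpha>)}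
    = (1 - measure N {..<\<alpha>} ^ e) ^ card L"
proof -
  interpret N: prob_space N by fact
  let ?P = "PiM I (\<lambda>_. N)"
  interpret P: prob_space ?P by (rule prob_space_PiM) (rule N(1))
  have ind: "P.indep_vars (\<lambda>_. N) (\<lambda>i \<omega>. \<omega> i) I"
    by (rule indep_vars_PiM_component) (rule N(1))
  have N_less: "{..<\<alpha>} \<in> sets N" using N by simp
  have component: "P.prob {\<omega> \<in> space ?P. \<omega> i < \<alpha>} = measure N {..<\<alpha>}" if "i \<in> I" for i
  proof -
    have "measure N {..<\<alpha>} = measure (distr ?P N (\<lambda>\<omega>. \<omega> i)) {..<\<alpha>}"
      using that N by (subst distr_PiM_component) auto
    also have "\<dots> = P.prob {\<omega> \<in> space ?P. \<omega> i < \<alpha>}"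
      using that N_less by (subst measure_distr) (auto intro!: arg_cong[where f = P.prob])
    finally show ?thesis ..
  qed
  have meas [measurable]: "Measurable.pred N (\<lambda>x. x < \<alpha>)"
    using N_less unfolding pred_def by (simp add: lessThan_def sets_eq_imp_space_eq[OF N(2)])
  have block: "P.prob {\<omega> \<in> space ?P. \<forall>i\<in>K m. \<omega> i < \<alpha>} = measure N {..<\<alpha>} ^ e" if m: "m \<in> L" for m
  proof (cases "K m = {}")
    case True
    then show ?thesis using K(3)[OF m] P.prob_space by simp
  next
    case False
    have "P.indep_events (\<lambda>i. {\<omega> \<in> space ?P. \<omega> i < \<alpha>}) I"
      by (rule P.indep_eventsI_indep_vars[OF ind]) measurable
    then have "P.prob (\<Inter>i\<in>K m. {\<omega> \<in> space ?P. \<omega> i < \<alpha>}) = (\<Prod>i\<in>K m. P.prob {\<omega> \<in> space ?P. \<omega> i < \<alpha>})"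
      using K[OF m] False unfolding P.indep_events_def by blast
    also have "\<dots> = measure N {..<\<alpha>} ^ e"
      using component K[OF m] by (simp add: subset_iff)
    also have "(\<Inter>i\<in>K m. {\<omega> \<in> space ?P. \<omega> i < \<alpha>}) = {\<omega> \<in> space ?P. \<forall>i\<in>K m. \<omega> i < \<alpha>}"
      using False by auto
    finally show ?thesis .
  qed
  have comp_meas: "{\<omega> \<in> space ?P. \<forall>i\<in>K m. \<omega> i < \<alpha>} \<in> P.events" if m: "m \<in> L" for m
  proof -
    have [measurable]: "(\<lambda>\<omega>. \<omega> i) \<in> measurable ?P N" if "i \<in> K m" for i
      using K(1)[OF m] that by (intro measurable_component_singleton) auto
    show ?thesis using K(2)[OF m] by measurable
  qed
  \<comment> \<open>\<open>Q\<close> reads only coordinates in \<open>K m\<close>, so the failure of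
    a block is an event of the restricted family, and independence of these families carries
    over.\<close>
  define Q where "Q m f \<longleftrightarrow> \<not> (\<forall>i\<in>K m. f i < \<alpha>)" for m and f :: "'i \<Rightarrow> real"
  have ind': "P.indep_vars (\<lambda>m. PiM (K m) (\<lambda>_. N)) (\<lambda>m \<omega>. restrict (\<lambda>i. \<omega> i) (K m)) L"
    by (rule P.indep_vars_restrict[OF ind K(1) disj])
  have "P.indep_events (\<lambda>m. {\<omega> \<in> space ?P. Q m (restrict (\<lambda>i. \<omega> i) (K m))}) L"
  proof (rule P.indep_eventsI_indep_vars[OF ind'])
    fix m assume "m \<in> L"
    then show "{f \<in> space (PiM (K m) (\<lambda>_. N)). Q m f} \<in> sets (PiM (K m) (\<lambda>_. N))"
      unfolding Q_def using K(2) by measurable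
  qed
  then have ev: "P.indep_events (\<lambda>m. {\<omega> \<in> space ?P. \<not> (\<forall>i\<in>K m. \<omega> i < \<alpha>)}) L"
    by (simp add: Q_def)
  show ?thesis
  proof (cases "L = {}")
    case True
    then show ?thesis using P.prob_space by simp
  next
    case False
    have "{U \<in> space ?P. \<forall>m\<in>L. \<not> (\<forall>i\<in>K m. U i < \<alpha>)} = (\<Inter>m\<in>L. {\<omega> \<in> space ?P. \<not> (\<forall>i\<in>K m. \<omega> i < \<alpha>)})"
      using False by auto
    also have "P.prob \<dots> = (\<Prod>m\<in>L. P.prob {\<omega> \<in> space ?P. \<not> (\<forall>i\<in>K m. \<omega> i < \<alpha>)})"
      using ev False \<open>finite L\<close> unfolding P.indep_events_def by blast
    also have "\<dots> = (\<Prod>m\<in>L. 1 - measure N {..<\<alpha>} ^ e)"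
    proof (intro prod.cong refl)
      fix m assume m: "m \<in> L"
      show "P.prob {\<omega> \<in> space ?P. \<not> (\<forall>i\<in>K m. \<omega> i < \<alpha>)} = 1 - measure N {..<\<alpha>} ^ e"
        using P.prob_neg[OF comp_meas[OF m]] block[OF m] by simp
    qed
    finally show ?thesis by simp
  qed
qed

section \<open>The model measure and the failure of one pair\<close>

abbreviation cube_measure :: "(real^'d::finite) measure" where
  "cube_measure \<equiv> uniform_measure lborel (cbox 0 One)"

abbreviation unit_measure :: "real measure" where
  "unit_measure \<equiv> uniform_measure lborel {0..1}"

lemma emeasure_lborel_unit_cube: "emeasure lborel (cbox 0 One :: (real^'d::finite) set) = 1"
  by (subst emeasure_lborel_cbox) (auto simp: prod.neutral)

lemma prob_space_cube_measure: "prob_space (cube_measure :: (real^'d::finite) measure)"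
  by (rule prob_space_uniform_measure) (simp_all add: emeasure_lborel_unit_cube del: emeasure_lborel_cbox)

lemma prob_space_unit_measure: "prob_space unit_measure"
  by (rule prob_space_uniform_measure) simp_all

lemma measure_unit_lessThan:
  assumes "0 \<le> \<alpha>" "\<alpha> \<le> 1"
  shows "measure unit_measure {..<\<alpha>} = \<alpha>"
proof -
  have "{0..1} \<inter> {..<\<alpha>} = {0..<\<alpha>}" using assms by auto
  then show ?thesis using assms by (subst measure_uniform_measure) auto
qed

lemma prob_space_sample_space: "prob_space (sample_space n :: ((nat \<Rightarrow> real^'d::finite) \<times> _) measure)"
  unfolding sample_space_def
proof (rule prob_space_pair)
  show "prob_space (PiM {..<n} (\<lambda>_. cube_measure :: (real^'d) measure))"
    by (rule prob_space_PiM) (rule prob_space_cube_measure)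
  show "prob_space (PiM {(i, j). i < j \<and> j < n} (\<lambda>_. unit_measure))"
    by (rule prob_space_PiM) (rule prob_space_unit_measure)
qed

text \<open>Given the positions, the candidates fail independently because their blocks are
  disjoint; given the positions of \<open>k\<close> and \<open>j\<close>, the other
  \<open>n - 2\<close> positions are independent. Integrating in this order bounds each factor by
  \<open>1 - \<alpha> ^ e * v\<close>. The event includes membership of \<open>k\<close> and
  \<open>j\<close> in the cube, where the bound \<open>v\<close> is available.\<close>

lemma link_failure_prob:
  fixes W :: "real^'d::finite \<Rightarrow> real^'d \<Rightarrow> real^'d \<Rightarrow> bool" and K :: "nat \<Rightarrow> (nat \<times> nat) set"
  assumes kj: "k < n" "j < n" "k \<noteq> j"
    and W: "Measurable.pred (borel \<Otimes>\<^sub>M borel \<Otimes>\<^sub>M borel) (\<lambda>(p, q, z). W p q z)"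
    and v: "\<And>p q. p \<in> cbox 0 One \<Longrightarrow> q \<in> cbox 0 One \<Longrightarrow> v \<le> measure cube_measure {z. W p q z}"
    and \<alpha>: "0 \<le> \<alpha>" "\<alpha> \<le> 1" and v01: "0 \<le> v" "v \<le> 1"
    and K: "\<And>m. m \<in> {..<n} - {k, j} \<Longrightarrow> K m \<subseteq> {(i, j). i < j \<and> j < n}"
      "\<And>m. m \<in> {..<n} - {k, j} \<Longrightarrow> card (K m) = e" "disjoint_family_on K ({..<n} - {k, j})"
  defines "Bad \<equiv> {\<omega> \<in> space (sample_space n). fst \<omega> k \<in> cbox 0 One \<and> fst \<omega> j \<in> cbox 0 One \<and>
      (\<forall>m\<in>{..<n} - {k, j}. \<not> (W (fst \<omega> k) (fst \<omega> j) (fst \<omega> m) \<and> (\<forall>i\<in>K m. snd \<omega> i < \<alpha>)))}"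
  shows "Bad \<in> sets (sample_space n)" "measure (sample_space n) Bad \<le> (1 - \<alpha> ^ e * v) ^ (n - 2)"
proof -
  define L where "L = {..<n} - {k, j}"
  let ?I2 = "{(i, j). i < j \<and> j < n}"
  let ?P1 = "PiM {..<n} (\<lambda>_. cube_measure :: (real^'d) measure)"
  let ?P2 = "PiM ?I2 (\<lambda>_. unit_measure)"
  have finI2: "finite ?I2" by (rule finite_subset[of _ "{..<n} \<times> {..<n}"]) auto
  have finL: "finite L" and cardL: "card L = n - 2" and insL: "{..<n} = insert k (insert j L)"
    and notL: "k \<notin> insert j L" "j \<notin> L"
    using kj by (auto simp: L_def card_Diff_subset)
  have finK: "finite (K m)" if "m \<in> L" for m
    using K(1) that finI2 finite_subset unfolding L_def by blast
  interpret C: prob_space "cube_measure :: (real^'d) measure" by (rule prob_space_cube_measure)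
  interpret P2: prob_space ?P2 by (rule prob_space_PiM) (rule prob_space_unit_measure)
  interpret S: prob_space "sample_space n :: ((nat \<Rightarrow> real^'d) \<times> _) measure"
    by (rule prob_space_sample_space)
  interpret PS: product_sigma_finite "\<lambda>_::nat. cube_measure :: (real^'d) measure"
    by unfold_locales
  have W_meas [measurable (raw)]: "Measurable.pred N (\<lambda>\<omega>. W (f \<omega>) (g \<omega>) (h \<omega>))"
    if "f \<in> borel_measurable N" "g \<in> borel_measurable N" "h \<in> borel_measurable N" for N and f g h :: "'b \<Rightarrow> real^'d"
  proof -
    have "(\<lambda>\<omega>. (f \<omega>, g \<omega>, h \<omega>)) \<in> measurable N (borel \<Otimes>\<^sub>M borel \<Otimes>\<^sub>M borel)"
      using that by measurable
    from measurable_compose[OF this W] show ?thesis by simp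
  qed
  have comp1 [measurable]: "(\<lambda>x. x i) \<in> borel_measurable ?P1" if "i < n" for i
    using measurable_component_singleton[of i "{..<n}" "\<lambda>_. cube_measure :: (real^'d) measure"] that
    by (simp cong: measurable_cong_sets)
  have comp2 [measurable]: "(\<lambda>x. x i) \<in> borel_measurable ?P2" if "i \<in> ?I2" for i
    using measurable_component_singleton[of i ?I2 "\<lambda>_. unit_measure"] that
    by (simp cong: measurable_cong_sets)
  have Bad_sets: "Bad \<in> sets (?P1 \<Otimes>\<^sub>M ?P2)"
  proof -
    have [measurable]: "(\<lambda>\<omega>. fst \<omega> i) \<in> borel_measurable (?P1 \<Otimes>\<^sub>M ?P2)" if "i < n" for i
      using comp1[OF that] by measurable
    have [measurable]: "(\<lambda>\<omega>. snd \<omega> i) \<in> borel_measurable (?P1 \<Otimes>\<^sub>M ?P2)" if "i \<in> ?I2" for i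
      using comp2[OF that] by measurable
    have [measurable]: "Measurable.pred (?P1 \<Otimes>\<^sub>M ?P2) (\<lambda>\<omega>. \<forall>i\<in>K m. snd \<omega> i < \<alpha>)" if "m \<in> L" for m
    proof (rule pred_intros_finite(3)[OF finK[OF that]])
      fix i assume "i \<in> K m"
      then have "i \<in> ?I2" using K(1)[of m] that by (auto simp: L_def)
      then show "Measurable.pred (?P1 \<Otimes>\<^sub>M ?P2) (\<lambda>\<omega>. snd \<omega> i < \<alpha>)" by measurable
    qed
    have [measurable]: "Measurable.pred (?P1 \<Otimes>\<^sub>M ?P2)
      (\<lambda>\<omega>. \<forall>m\<in>L. \<not> (W (fst \<omega> k) (fst \<omega> j) (fst \<omega> m) \<and> (\<forall>i\<in>K m. snd \<omega> i < \<alpha>)))"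
    proof (rule pred_intros_finite(3)[OF finL])
      fix m assume m: "m \<in> L"
      then have [simp]: "m < n" by (auto simp: L_def)
      show "Measurable.pred (?P1 \<Otimes>\<^sub>M ?P2)
        (\<lambda>\<omega>. \<not> (W (fst \<omega> k) (fst \<omega> j) (fst \<omega> m) \<and> (\<forall>i\<in>K m. snd \<omega> i < \<alpha>)))"
        using kj m by measurable
    qed
    show ?thesis unfolding Bad_def L_def[symmetric] sample_space_def using kj by measurable
  qed
  then show "Bad \<in> sets (sample_space n)" by (simp add: sample_space_def)
  \<comment> \<open>\<open>g\<close> is the conditional probability that a node at \<open>z\<close>
    fails to link \<open>p\<close> and \<open>q\<close>; \<open>c\<close> below encodes membership
    in the cube as a factor.\<close>
  define g where "g p q z = ennreal (if W p q z then 1 - \<alpha> ^ e else 1)" for p q z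
  define c where "c p = (indicator (cbox 0 One) p :: ennreal)" for p :: "real^'d"
  have \<alpha>e: "0 \<le> \<alpha> ^ e" "\<alpha> ^ e \<le> 1" using \<alpha> by (auto intro: power_le_one)
  have fibre: "emeasure ?P2 (Pair x -` Bad) = c (x k) * c (x j) * (\<Prod>m\<in>L. g (x k) (x j) (x m))"
    if x: "x \<in> space ?P1" for x
  proof (cases "x k \<in> cbox 0 One \<and> x j \<in> cbox 0 One")
    case False
    then have "Pair x -` Bad = {}" by (auto simp: Bad_def)
    then show ?thesis using False by (auto simp: c_def)
  next
    case True
    define L' where "L' = {m \<in> L. W (x k) (x j) (x m)}"
    have L': "L' \<subseteq> L" "finite L'" using finL by (auto simp: L'_def)
    \<comment> \<open>Nodes outside the region fail automatically, so only the blocks of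
      \<open>L'\<close> constrain \<open>U\<close>.\<close>
    have "Pair x -` Bad = {U \<in> space ?P2. \<forall>m\<in>L'. \<not> (\<forall>i\<in>K m. U i < \<alpha>)}"
      using True x by (auto simp: Bad_def L'_def L_def sample_space_def space_pair_measure)
    also have "emeasure ?P2 \<dots> = ennreal ((1 - measure unit_measure {..<\<alpha>} ^ e) ^ card L')"
      unfolding P2.emeasure_eq_measure
    proof (rule arg_cong[of _ _ ennreal], rule prob_no_block_below[OF prob_space_unit_measure _ L'(2)])
      show "K m \<subseteq> ?I2" "finite (K m)" "card (K m) = e" if "m \<in> L'" for m
        using L'(1) that K(1,2)[of m] finK[of m] unfolding L_def by blast+
      show "disjoint_family_on K L'"
        using disjoint_family_on_mono[OF _ K(3)] L'(1) unfolding L_def by blast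
    qed simp
    also have "\<dots> = ennreal ((1 - \<alpha> ^ e) ^ card L')"
      unfolding measure_unit_lessThan[OF \<alpha>] ..
    also have "(1 - \<alpha> ^ e) ^ card L' = (\<Prod>m\<in>L. if W (x k) (x j) (x m) then 1 - \<alpha> ^ e else 1)"
      unfolding L'_def using finL by (simp add: prod.If_cases Int_def)
    also have "ennreal \<dots> = (\<Prod>m\<in>L. g (x k) (x j) (x m))"
      unfolding g_def using \<alpha>e by (subst prod_ennreal) auto
    finally show ?thesis using True by (simp add: c_def)
  qed
  have g_integral: "(\<integral>\<^sup>+z. g p q z \<partial>cube_measure) \<le> ennreal (1 - \<alpha> ^ e * v)"
    if "p \<in> cbox 0 One" "q \<in> cbox 0 One" for p q
  proof -
    have "Measurable.pred borel (W p q)"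
      by (rule W_meas) auto
    then have [measurable]: "{z. W p q z} \<in> sets borel"
      unfolding pred_def space_borel by (simp only: UNIV_I simp_thms)
    have int: "integrable cube_measure (indicator {z. W p q z} :: _ \<Rightarrow> real)"
      by (rule integrable_real_indicator) (simp, simp only: C.emeasure_eq_measure ennreal_less_top infinity_ennreal_def)
    have "(\<integral>\<^sup>+z. g p q z \<partial>cube_measure) = (\<integral>\<^sup>+z. ennreal (1 - \<alpha> ^ e * indicator {z. W p q z} z) \<partial>cube_measure)"
      by (intro nn_integral_cong) (auto simp: g_def)
    also have "\<dots> = ennreal (\<integral>z. 1 - \<alpha> ^ e * indicator {z. W p q z} z \<partial>cube_measure)"
      using \<alpha>e int by (intro nn_integral_eq_integral) (auto split: split_indicator)
    also have "(\<integral>z. 1 - \<alpha> ^ e * indicator {z. W p q z} z \<partial>cube_measure) = 1 - \<alpha> ^ e * C.prob {z. W p q z}"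
      using int C.prob_space by (subst Bochner_Integration.integral_diff) auto
    also have "ennreal \<dots> \<le> ennreal (1 - \<alpha> ^ e * v)"
      using v[OF that] \<alpha>e by (intro ennreal_leI) (auto intro: mult_left_mono)
    finally show ?thesis .
  qed
  have g_meas [measurable (raw)]: "(\<lambda>\<omega>. g (f \<omega>) (f' \<omega>) (h \<omega>)) \<in> borel_measurable N"
    if "f \<in> borel_measurable N" "f' \<in> borel_measurable N" "h \<in> borel_measurable N" for N and f f' h :: "'b \<Rightarrow> real^'d"
    unfolding g_def using W_meas[OF that] by measurable
  have c_meas [measurable]: "c \<in> borel_measurable borel" unfolding c_def by measurable
  define F where "F x = c (x k) * c (x j) * (\<Prod>m\<in>L. g (x k) (x j) (x m))" for x :: "nat \<Rightarrow> real^'d"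
  have "emeasure (sample_space n) Bad = (\<integral>\<^sup>+x. emeasure ?P2 (Pair x -` Bad) \<partial>?P1)"
    unfolding sample_space_def by (rule P2.emeasure_pair_measure_alt[OF Bad_sets])
  also have "\<dots> = (\<integral>\<^sup>+x. F x \<partial>?P1)"
    by (intro nn_integral_cong) (simp add: fibre F_def)
  \<comment> \<open>The positions of \<open>k\<close> and \<open>j\<close> are peeled off first;
    with both fixed, the remaining integrand is a product over independent coordinates.\<close>
  also have "\<dots> = (\<integral>\<^sup>+x. F x \<partial>PiM (insert k (insert j L)) (\<lambda>_. cube_measure))"
    by (simp only: insL)
  also have "\<dots> = (\<integral>\<^sup>+p. (\<integral>\<^sup>+x. F (x(k := p)) \<partial>PiM (insert j L) (\<lambda>_. cube_measure)) \<partial>cube_measure)"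
  proof (rule PS.product_nn_integral_insert_rev)
    have "F \<in> borel_measurable ?P1"
      unfolding F_def using kj by (intro borel_measurable_times_ennreal borel_measurable_prod_ennreal)
        (auto simp: L_def intro!: g_meas comp1 measurable_compose[OF comp1 c_meas])
    then show "F \<in> borel_measurable (PiM (insert k (insert j L)) (\<lambda>_. cube_measure))"
      by (simp only: insL)
  qed (use finL notL in auto)
  also have "\<dots> \<le> (\<integral>\<^sup>+p. ennreal ((1 - \<alpha> ^ e * v) ^ (n - 2)) \<partial>(cube_measure :: (real^'d) measure))"
  proof (rule nn_integral_mono)
    fix p :: "real^'d"
    have cmp: "(\<lambda>x. x i) \<in> borel_measurable (PiM J (\<lambda>_. cube_measure :: (real^'d) measure))" if "i \<in> J" for i :: nat and J
      using measurable_component_singleton[of i J "\<lambda>_. cube_measure :: (real^'d) measure"] that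
      by (simp cong: measurable_cong_sets)
    have upd: "F (x(k := p)) = c p * c (x j) * (\<Prod>m\<in>L. g p (x j) (x m))" for x
      using kj by (auto simp: F_def L_def intro!: prod.cong)
    have "(\<integral>\<^sup>+x. F (x(k := p)) \<partial>PiM (insert j L) (\<lambda>_. cube_measure))
      = (\<integral>\<^sup>+q. (\<integral>\<^sup>+x. F (x(j := q, k := p)) \<partial>PiM L (\<lambda>_. cube_measure)) \<partial>cube_measure)"
    proof (rule PS.product_nn_integral_insert_rev)
      show "(\<lambda>x. F (x(k := p))) \<in> borel_measurable (PiM (insert j L) (\<lambda>_. cube_measure))"
        unfolding upd by (intro borel_measurable_times_ennreal borel_measurable_prod_ennreal)
          (auto intro!: g_meas cmp measurable_compose[OF cmp c_meas])
    qed (use finL notL in auto)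
    also have "\<dots> \<le> (\<integral>\<^sup>+q. ennreal ((1 - \<alpha> ^ e * v) ^ (n - 2)) \<partial>(cube_measure :: (real^'d) measure))"
    proof (rule nn_integral_mono)
      fix q :: "real^'d"
      have upd': "F (x(j := q, k := p)) = c p * c q * (\<Prod>m\<in>L. g p q (x m))" for x
        unfolding upd using kj by (auto simp: L_def intro!: prod.cong)
      show "(\<integral>\<^sup>+x. F (x(j := q, k := p)) \<partial>PiM L (\<lambda>_. cube_measure)) \<le> ennreal ((1 - \<alpha> ^ e * v) ^ (n - 2))"
      proof (cases "p \<in> cbox 0 One \<and> q \<in> cbox 0 One")
        case False
        then show ?thesis by (auto simp: upd' c_def)
      next
        case True
        then have "(\<integral>\<^sup>+x. F (x(j := q, k := p)) \<partial>PiM L (\<lambda>_. cube_measure))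
            = (\<integral>\<^sup>+x. (\<Prod>m\<in>L. g p q (x m)) \<partial>PiM L (\<lambda>_. cube_measure))"
          by (simp add: upd' c_def)
        also have "\<dots> = (\<Prod>m\<in>L. \<integral>\<^sup>+z. g p q z \<partial>cube_measure)"
          by (rule PS.product_nn_integral_prod[OF finL]) (auto intro!: g_meas measurable_ident_sets)
        also have "\<dots> \<le> (\<Prod>m\<in>L. ennreal (1 - \<alpha> ^ e * v))"
          using True by (intro prod_mono_ennreal g_integral) auto
        also have "\<dots> = ennreal ((1 - \<alpha> ^ e * v) ^ (n - 2))"
          using \<alpha>e v01 by (simp add: cardL ennreal_power mult_le_one)
        finally show ?thesis .
      qed
    qed
    finally show "(\<integral>\<^sup>+x. F (x(k := p)) \<partial>PiM (insert j L) (\<lambda>_. cube_measure)) \<le> ennreal ((1 - \<alpha> ^ e * v) ^ (n - 2))"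
      by (simp add: C.emeasure_space_1[simplified])
  qed
  also have "\<dots> = ennreal ((1 - \<alpha> ^ e * v) ^ (n - 2))"
    by (simp add: C.emeasure_space_1[simplified])
  finally show "measure (sample_space n) Bad \<le> (1 - \<alpha> ^ e * v) ^ (n - 2)"
    using \<alpha>e v01 by (simp add: S.emeasure_eq_measure mult_le_one)
qed

section \<open>Volumes and measurability of the two regions\<close>

lemma measure_subcube_diff:
  fixes y p q :: "real^'d::finite"
  assumes y: "y \<in> cbox 0 One" and s: "0 \<le> s" "s \<le> 1"
  shows "measure cube_measure (subcube y s - {p, q}) = s ^ CARD('d)"
proof -
  have null: "{p, q} \<in> null_sets lborel" by (rule finite_imp_null_set_lborel) simp
  have sets: "subcube y s \<in> sets lborel" by (simp add: subcube_def)
  have inter: "cbox 0 One \<inter> (subcube y s - {p, q}) = subcube y s - {p, q}"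
    using subcube_subset[OF y s] by auto
  have "measure lborel (subcube y s) = (\<Prod>i\<in>(Basis::(real^'d) set). s)"
    unfolding subcube_def
  proof (subst content_cbox)
    have One_inner: "(One::real^'d) \<bullet> i = 1" if "i \<in> Basis" for i
      using that by (rule inner_sum_Basis)
    show "\<forall>i\<in>Basis. ((1 - s) *\<^sub>R y) \<bullet> i \<le> ((1 - s) *\<^sub>R y + s *\<^sub>R One) \<bullet> i"
      using s by (simp only: inner_add_left inner_scaleR_left One_inner, simp)
    show "(\<Prod>i\<in>Basis. ((1 - s) *\<^sub>R y + s *\<^sub>R One) \<bullet> i - ((1 - s) *\<^sub>R y) \<bullet> i) = (\<Prod>i\<in>(Basis::(real^'d) set). s)"
    proof (rule prod.cong[OF refl])
      fix i :: "real^'d" assume "i \<in> Basis"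
      then show "((1 - s) *\<^sub>R y + s *\<^sub>R One) \<bullet> i - ((1 - s) *\<^sub>R y) \<bullet> i = s"
        unfolding inner_add_left inner_scaleR_left by (simp only: One_inner)
    qed
  qed
  also have "\<dots> = s ^ CARD('d)" by simp
  finally have "measure lborel (subcube y s - {p, q}) = s ^ CARD('d)"
    using measure_Diff_null_set[OF sets null] by simp
  moreover have "measure cube_measure (subcube y s - {p, q})
      = measure lborel (cbox 0 One \<inter> (subcube y s - {p, q})) / measure lborel (cbox 0 One :: (real^'d) set)"
    using sets null
    by (intro measure_uniform_measure) (simp_all only: emeasure_lborel_unit_cube, auto)
  moreover have "measure lborel (cbox 0 One :: (real^'d) set) = 1"
    unfolding measure_def emeasure_lborel_unit_cube by simp
  ultimately show ?thesis unfolding inter by simp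
qed

lemma measurable_vec_nth [measurable (raw)]:
  assumes "f \<in> borel_measurable M"
  shows "(\<lambda>x. (f x :: real^'d::finite) $ k) \<in> borel_measurable M"
  by (rule measurable_compose[OF assms])
    (auto intro!: borel_measurable_continuous_onI continuous_intros)

lemma pred_subcube [measurable (raw)]:
  assumes "f \<in> borel_measurable M" "g \<in> borel_measurable M"
  shows "Measurable.pred M (\<lambda>x. f x \<in> subcube (g x :: real^'d::finite) s)"
  unfolding mem_subcube using assms by measurable

lemma measurable_forward_region:
  "Measurable.pred (borel \<Otimes>\<^sub>M borel \<Otimes>\<^sub>M borel) (\<lambda>(p, q, z :: real^'d::finite). forward_region r s p q z)"
  unfolding forward_region_def target_def Diff_iff insert_iff empty_iff by measurable

lemma measurable_middle_region:
  "Measurable.pred (borel \<Otimes>\<^sub>M borel \<Otimes>\<^sub>M borel) (\<lambda>(p, q, z :: real^'d::finite). middle_region s p q z)"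
  unfolding middle_region_def midpoint_def Diff_iff insert_iff empty_iff by measurable

lemma measure_forward_region:
  fixes p q :: "real^'d::finite"
  assumes "p \<in> cbox 0 One" "q \<in> cbox 0 One" "0 \<le> r" "0 \<le> s" "s \<le> 1"
  shows "measure cube_measure {z. forward_region r s p q z} = s ^ CARD('d)"
  unfolding forward_region_def Collect_mem_eq
  using target_in_convex[of "cbox 0 One" p q r] assms by (intro measure_subcube_diff) auto

lemma measure_middle_region:
  fixes p q :: "real^'d::finite"
  assumes "p \<in> cbox 0 One" "q \<in> cbox 0 One" "0 \<le> s" "s \<le> 1"
  shows "measure cube_measure {z. middle_region s p q z} = s ^ CARD('d)"
proof -
  have "closed_segment p q \<subseteq> cbox 0 One" using assms by (intro closed_segment_subset) auto
  then have "midpoint p q \<in> cbox 0 One" using midpoint_in_closed_segment by blast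
  from measure_subcube_diff[OF this assms(3,4)] show ?thesis
    unfolding middle_region_def Collect_mem_eq .
qed

subsection \<open>Concentration of the sample moments\<close>

lemma AE_cube_measure: "AE z in cube_measure. (z::real^'d::finite) \<in> cbox 0 One"
  by (rule AE_uniform_measureI) auto

lemma nn_integral_unit_power:
  "(\<integral>\<^sup>+x. ennreal (x ^ k * indicator {0..1} x) \<partial>lborel) = ennreal (1 / (real k + 1))"
proof -
  have "(\<integral>\<^sup>+x. ennreal (x ^ k * indicator {0..1} x) \<partial>lborel)
      = (\<integral>\<^sup>+x. ennreal (x ^ k) * indicator {0..1} x \<partial>lborel)"
    by (intro nn_integral_cong) (auto split: split_indicator)
  also have "\<dots> = ennreal (1 ^ Suc k / (real k + 1) - 0 ^ Suc k / (real k + 1))"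
  proof (rule nn_integral_FTC_Icc)
    show "((\<lambda>x. x ^ Suc k / (real k + 1)) has_real_derivative x ^ k) (at x)" for x :: real
      by (rule DERIV_cong[OF DERIV_cdivide[OF DERIV_pow]]) (simp add: field_simps)
  qed auto
  finally show ?thesis by simp
qed

text \<open>Lebesgue measure and the indicator of the cube both factor over the coordinates. The
  computation runs through \<open>nn_integral\<close>, as monomials are nonnegative almost
  surely.\<close>

lemma integral_cube_monomial:
  fixes j :: "'d::finite \<Rightarrow> nat"
  shows "(\<integral>z. (\<Prod>a\<in>UNIV. (z $ a) ^ j a) \<partial>cube_measure) = (\<Prod>a\<in>UNIV. 1 / (real (j a) + 1))"
proof -
  let ?f = "\<lambda>z::real^'d. \<Prod>a\<in>UNIV. (z $ a) ^ j a"
  have basis: "bij_betw (\<lambda>a. axis a 1) (UNIV::'d set) (Basis :: (real^'d) set)"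
    by (rule bij_betwI') (auto simp: axis_eq_axis Basis_vec_def)
  have "(\<integral>\<^sup>+z. ennreal (?f z) \<partial>cube_measure) = (\<integral>\<^sup>+z. ennreal (?f z) * indicator (cbox 0 One) z \<partial>lborel)"
    by (subst nn_integral_uniform_measure)
      (auto simp: emeasure_lborel_unit_cube divide_ennreal_def simp del: emeasure_lborel_cbox)
  also have "\<dots> = (\<integral>\<^sup>+(z::real^'d). (\<Prod>b\<in>Basis. ennreal ((z \<bullet> b) ^ j (axis_index b) * indicator {0..1} (z \<bullet> b))) \<partial>lborel)"
  proof (rule nn_integral_cong)
    fix z :: "real^'d"
    have "(\<Prod>b\<in>Basis. ennreal ((z \<bullet> b) ^ j (axis_index b) * indicator {0..1} (z \<bullet> b)))
      = (\<Prod>a\<in>UNIV. ennreal ((z $ a) ^ j a * indicator {0..1} (z $ a)))"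
      by (subst prod.reindex_bij_betw[OF basis, symmetric]) (simp add: cart_eq_inner_axis[symmetric])
    also have "\<dots> = ennreal (?f z) * indicator (cbox 0 One) z"
    proof (cases "z \<in> cbox 0 One")
      case True
      then show ?thesis by (subst prod_ennreal) (auto simp: mem_unit_cube)
    next
      case False
      then obtain a where "z $ a \<notin> {0..1}" by (auto simp: mem_unit_cube)
      then have "(\<Prod>a\<in>UNIV. ennreal ((z $ a) ^ j a * indicator {0..1} (z $ a))) = 0"
        by (intro prod_zero bexI[of _ a]) (auto simp: indicator_def)
      then show ?thesis using False by simp
    qed
    finally show "ennreal (?f z) * indicator (cbox 0 One) z
      = (\<Prod>b\<in>Basis. ennreal ((z \<bullet> b) ^ j (axis_index b) * indicator {0..1} (z \<bullet> b)))" ..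
  qed
  also have "\<dots> = (\<Prod>b\<in>Basis. \<integral>\<^sup>+x. ennreal (x ^ j (axis_index (b::real^'d)) * indicator {0..1} x) \<partial>lborel)"
    by (rule nn_integral_lborel_prod) simp_all
  also have "\<dots> = (\<Prod>a\<in>UNIV. ennreal (1 / (real (j a) + 1)))"
    unfolding nn_integral_unit_power by (subst prod.reindex_bij_betw[OF basis, symmetric]) simp
  also have "\<dots> = ennreal (\<Prod>a\<in>UNIV. 1 / (real (j a) + 1))"
    by (rule prod_ennreal) simp
  finally have nn: "(\<integral>\<^sup>+z. ennreal (?f z) \<partial>cube_measure) = ennreal (\<Prod>a\<in>UNIV. 1 / (real (j a) + 1))" .
  have "AE z in cube_measure. 0 \<le> ?f z"
    by (rule AE_mp[OF AE_cube_measure]) (auto simp: mem_unit_cube intro!: prod_nonneg)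
  then show ?thesis
    by (subst integral_eq_nn_integral) (auto simp: nn prod_nonneg)
qed

lemma integral_cube_coordinate: "(\<integral>z. z $ a \<partial>(cube_measure :: (real^'d::finite) measure)) = 1/2"
proof -
  have mono: "(\<Prod>c\<in>UNIV. (z $ c) ^ (if c = a then 1 else 0)) = z $ a" for z :: "real^'d"
    by (simp add: if_distrib[of "\<lambda>k. _ ^ k"] cong: if_cong)
  have "(\<Prod>c\<in>(UNIV::'d set). 1 / (real (if c = a then 1 else 0) + 1)) = (\<Prod>c\<in>UNIV. if c = a then 1/2 else 1)"
    by (intro prod.cong) auto
  then show ?thesis
    using integral_cube_monomial[of "\<lambda>c. if c = a then 1 else 0"] unfolding mono by simp
qed

lemma integral_cube_coordinate_product:
  "(\<integral>z. z $ a * z $ b \<partial>(cube_measure :: (real^'d::finite) measure)) = (if a = b then 1/3 else 1/4)"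
proof -
  \<comment> \<open>Adding the two exponents covers the square (\<open>a = b\<close>) and the mixed
    product at once.\<close>
  define j where "j c = (if c = a then 1 else 0) + (if c = b then 1 else 0 :: nat)" for c
  have mono: "(\<Prod>c\<in>UNIV. (z $ c) ^ j c) = z $ a * z $ b" for z :: "real^'d"
    by (simp add: j_def power_add prod.distrib if_distrib[of "\<lambda>k. _ ^ k"] cong: if_cong)
  have "(\<Prod>c\<in>(UNIV::'d set). 1 / (real (j c) + 1)) = (if a = b then 1/3 else 1/4)"
  proof (cases "a = b")
    case True
    then have "(\<Prod>c\<in>(UNIV::'d set). 1 / (real (j c) + 1)) = (\<Prod>c\<in>UNIV. if c = a then 1/3 else 1)"
      by (intro prod.cong) (auto simp: j_def)
    then show ?thesis using True by simp
  next
    case False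
    then have "(\<Prod>c\<in>(UNIV::'d set). 1 / (real (j c) + 1))
      = (\<Prod>c\<in>UNIV. (if c = a then 1/2 else 1) * (if c = b then 1/2 else 1))"
      by (intro prod.cong) (auto simp: j_def)
    then show ?thesis using False by (simp add: prod.distrib)
  qed
  then show ?thesis using integral_cube_monomial[of j] unfolding mono by simp
qed

text \<open>Hoeffding's inequality for independent variables with values almost surely in the unit
  interval.\<close>

lemma sample_mean_deviation_prob:
  fixes f :: "real^'d::finite \<Rightarrow> real"
  assumes f [measurable]: "f \<in> borel_measurable borel" and f01: "\<And>z. z \<in> cbox 0 One \<Longrightarrow> 0 \<le> f z \<and> f z \<le> 1"
    and n: "0 < n" and \<epsilon>: "0 \<le> \<epsilon>" and mean: "(\<integral>z. f z \<partial>cube_measure) = e"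
  defines "Dev \<equiv> {\<omega> \<in> space (sample_space n). real n * \<epsilon> \<le> \<bar>(\<Sum>i<n. f (fst \<omega> i)) - real n * e\<bar>}"
  shows "Dev \<in> sets (sample_space n)" "measure (sample_space n) Dev \<le> 2 * exp (- 2 * real n * \<epsilon>\<^sup>2)"
proof -
  let ?P1 = "PiM {..<n} (\<lambda>_. cube_measure :: (real^'d) measure)"
  let ?P2 = "PiM {(i, j). i < j \<and> j < n} (\<lambda>_. unit_measure)"
  interpret P1: prob_space ?P1 by (rule prob_space_PiM) (rule prob_space_cube_measure)
  interpret P2: prob_space ?P2 by (rule prob_space_PiM) (rule prob_space_unit_measure)
  have f': "f \<in> borel_measurable cube_measure" by simp
  have comp: "(\<lambda>x. x i) \<in> measurable ?P1 cube_measure" if "i < n" for i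
    using that by (intro measurable_component_singleton) auto
  have expect: "P1.expectation (\<lambda>x. f (x i)) = e" if "i < n" for i
  proof -
    have "e = (\<integral>z. f z \<partial>distr ?P1 cube_measure (\<lambda>x. x i))"
      using that by (subst distr_PiM_component) (auto simp: prob_space_cube_measure mean)
    also have "\<dots> = P1.expectation (\<lambda>x. f (x i))"
      by (rule integral_distr[OF comp[OF that] f'])
    finally show ?thesis ..
  qed
  interpret H: Hoeffding_ineq ?P1 "{..<n}" "\<lambda>i x. f (x i)" "\<lambda>_. 0" "\<lambda>_. 1"
    "\<Sum>i<n. P1.expectation (\<lambda>x. f (x i))"
  proof unfold_locales
    show "P1.indep_vars (\<lambda>_. borel) (\<lambda>i x. f (x i)) {..<n}"
      by (rule P1.indep_vars_compose2[OF indep_vars_PiM_component]) (auto simp: prob_space_cube_measure)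
    show "AE x in ?P1. f (x i) \<in> {0..1}" if "i \<in> {..<n}" for i
    proof (rule AE_PiM_component[OF _ that])
      show "AE z in cube_measure. f z \<in> {0..1}"
        by (rule AE_mp[OF AE_cube_measure]) (use f01 in auto)
    qed (rule prob_space_cube_measure)
  qed auto
  define D where "D = {x \<in> space ?P1. \<bar>(\<Sum>i<n. f (x i)) - real n * e\<bar> \<ge> real n * \<epsilon>}"
  have "P1.prob D \<le> 2 * exp (- 2 * (real n * \<epsilon>)\<^sup>2 / (\<Sum>i<n. (1 - 0)\<^sup>2))"
    using H.Hoeffding_ineq_abs_ge[of "real n * \<epsilon>"] n \<epsilon> by (simp add: D_def expect)
  also have "\<dots> = 2 * exp (- 2 * real n * \<epsilon>\<^sup>2)"
    using n by (simp add: power2_eq_square)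
  finally have le: "P1.prob D \<le> 2 * exp (- 2 * real n * \<epsilon>\<^sup>2)" .
  have D_sets: "D \<in> sets ?P1"
  proof -
    have [measurable]: "(\<lambda>x. f (x i)) \<in> borel_measurable ?P1" if "i \<in> {..<n}" for i
      using measurable_compose[OF comp f'] that by simp
    show ?thesis unfolding D_def by measurable
  qed
  \<comment> \<open>The event depends on the positions only and is therefore a cylinder.\<close>
  have Dev: "Dev = D \<times> space ?P2"
    by (auto simp: Dev_def D_def sample_space_def space_pair_measure)
  show "Dev \<in> sets (sample_space n)"
    unfolding Dev sample_space_def using D_sets by (intro pair_measureI) auto
  have "emeasure (sample_space n) Dev = emeasure ?P1 D * emeasure ?P2 (space ?P2)"
    unfolding Dev sample_space_def by (rule P2.emeasure_pair_measure_Times[OF D_sets]) simp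
  then have "measure (sample_space n) Dev = P1.prob D"
    by (simp add: measure_def P2.emeasure_space_1)
  then show "measure (sample_space n) Dev \<le> 2 * exp (- 2 * real n * \<epsilon>\<^sup>2)" using le by simp
qed

lemma AE_sample_in_cube:
  assumes "i < n"
  shows "AE \<omega> in sample_space n. fst \<omega> i \<in> cbox 0 (One :: real^'d::finite)"
proof -
  let ?P1 = "PiM {..<n} (\<lambda>_. cube_measure :: (real^'d) measure)"
  let ?P2 = "PiM {(i, j). i < j \<and> j < n} (\<lambda>_. unit_measure)"
  interpret P2: prob_space ?P2 by (rule prob_space_PiM) (rule prob_space_unit_measure)
  have ae: "AE x in ?P1. x i \<in> cbox 0 One"
    using assms by (intro AE_PiM_component AE_cube_measure prob_space_cube_measure) auto
  have fst: "distr (?P1 \<Otimes>\<^sub>M ?P2) ?P1 fst = ?P1" by (rule P2.distr_pair_fst)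
  have "AE x in distr (?P1 \<Otimes>\<^sub>M ?P2) ?P1 fst. x i \<in> cbox 0 One"
    unfolding fst by (rule ae)
  then show ?thesis unfolding sample_space_def by (rule AE_distrD[rotated]) simp
qed

subsection \<open>The event of high probability\<close>

lemma pair_eq_iff: "pair i j = pair i' j' \<longleftrightarrow> (i = i' \<and> j = j') \<or> (i = j' \<and> j = i')"
  by (auto simp: pair_def min_def max_def split: if_splits)

lemma pair_mem: "k < n \<Longrightarrow> m < n \<Longrightarrow> k \<noteq> m \<Longrightarrow> pair k m \<in> {(i, j). i < j \<and> j < n}"
  by (auto simp: pair_def min_def max_def)

lemma one_minus_power_le_exp:
  fixes t :: real
  assumes "0 \<le> t" "t \<le> 1"
  shows "(1 - t) ^ N \<le> exp (- (t * real N))"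
proof -
  have "(1 - t) ^ N \<le> exp (- t) ^ N"
    using assms exp_ge_add_one_self[of "- t"] by (intro power_mono) auto
  also have "\<dots> = exp (- (t * real N))" by (simp add: exp_of_nat_mult[symmetric] mult.commute)
  finally show ?thesis .
qed

text \<open>A union bound over at most \<open>n * n\<close> ordered pairs for each of the two link
  conditions and over at most \<open>3 + 9\<close> moment estimates. The result is a measurable
  \<open>A\<close> inside the good event; measurability of \<open>good_event\<close> itself is not
  asserted.\<close>

lemma good_event_prob:
  fixes n :: nat and \<alpha> \<beta> R :: real
  assumes d: "CARD('d::finite) \<le> 3" and n: "3 \<le> n" and \<alpha>: "0 < \<alpha>" "\<alpha> \<le> 1" and \<beta>: "0 \<le> \<beta>"
  defines "r0 \<equiv> (12 * ln (real n) / (\<alpha> * (real n - 2))) powr (1 / real CARD('d))"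
  defines "s' \<equiv> (1 / \<alpha>) powr (1 / real CARD('d)) * r0"
  assumes s'_le: "s' \<le> 1" and R: "32 * s' < R"
  shows "\<exists>A \<in> sets (sample_space n). (\<forall>\<omega>\<in>A. good_event \<alpha> \<beta> R n (\<omega> :: (nat \<Rightarrow> real^'d) \<times> _)) \<and>
    1 - (2 * (real n)\<^sup>2 * exp (- (5/2 * ln (real n))) + 24 * exp (- 2 * real n * (1/150)\<^sup>2)) \<le> measure (sample_space n) A"
proof -
  let ?\<Omega> = "sample_space n :: ((nat \<Rightarrow> real^'d) \<times> (nat \<times> nat \<Rightarrow> real)) measure"
  let ?d = "CARD('d)"
  interpret S: prob_space ?\<Omega> by (rule prob_space_sample_space)
  \<comment> \<open>The factor \<open>3/5\<close> is small enough for the distance estimates and still satisfies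
    \<open>12 * (3/5) ^ 3 > 5/2\<close>, which leaves room for a union bound over all pairs of nodes.\<close>
  define s where "s = 3/5 * r0"
  define r where "r = R - s * sqrt (real ?d)"
  have ln_pos: "0 < ln (real n)" using n by simp
  have r0_pos: "0 < r0" using n \<alpha> ln_pos by (simp add: r0_def)
  have root_power: "(x powr (1 / real ?d)) ^ ?d = x" if "0 < x" for x :: real
    using that by (simp add: powr_realpow[symmetric] powr_powr)
  have r0_power: "r0 ^ ?d = 12 * ln (real n) / (\<alpha> * (real n - 2))"
    unfolding r0_def using n \<alpha> ln_pos by (intro root_power) simp
  have s'_ge: "r0 \<le> s'"
  proof -
    have "1 \<le> (1 / \<alpha>) powr (1 / real ?d)" using \<alpha> by (intro ge_one_powr_ge_zero) auto
    then show ?thesis unfolding s'_def using r0_pos by simp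
  qed
  have s: "0 \<le> s" "s \<le> 1" using r0_pos s'_ge s'_le by (auto simp: s_def)
  have "sqrt (real ?d) \<le> 2" using d by (intro real_le_lsqrt) auto
  then have "s * sqrt (real ?d) \<le> s * 2" using s by (intro mult_left_mono) auto
  moreover have "s * 2 \<le> R" using R s'_ge r0_pos by (simp add: s_def)
  ultimately have r: "0 \<le> r" unfolding r_def by linarith
  have s'_pos: "0 \<le> s'" using s'_ge r0_pos by simp
  define F where "F = (forward_region r s :: real^'d \<Rightarrow> _)"
  define M where "M = (middle_region s' :: real^'d \<Rightarrow> _)"
  define Bad where "Bad W K k j = {\<omega> \<in> space ?\<Omega>. fst \<omega> k \<in> cbox 0 One \<and> fst \<omega> j \<in> cbox 0 One \<and>
      (\<forall>m\<in>{..<n} - {k, j}. \<not> (W (fst \<omega> k) (fst \<omega> j) (fst \<omega> m) \<and> (\<forall>i\<in>K m. snd \<omega> i < \<alpha>)))}"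
    for W :: "real^'d \<Rightarrow> real^'d \<Rightarrow> real^'d \<Rightarrow> bool" and K and k j :: nat
  define BF where "BF k j = Bad F (\<lambda>m. {pair k m}) k j" for k j
  define BM where "BM k j = Bad M (\<lambda>m. {pair k m, pair j m}) k j" for k j
  define \<delta> where "\<delta> = exp (- (5/2 * ln (real n)))"
  have BF: "BF k j \<in> S.events" "S.prob (BF k j) \<le> \<delta>" if kj: "k < n" "j < n" "k \<noteq> j" for k j
  proof -
    have v: "s ^ ?d \<le> measure cube_measure {z. F p q z}"
      if "p \<in> cbox 0 One" "q \<in> cbox 0 One" for p q
      unfolding F_def using measure_forward_region[OF that r s] by simp
    have K1: "{pair k m} \<subseteq> {(i, j). i < j \<and> j < n}" if "m \<in> {..<n} - {k, j}" for m
      using pair_mem[of k n m] that kj by auto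
    have K2: "disjoint_family_on (\<lambda>m. {pair k m}) ({..<n} - {k, j})"
      by (auto simp: disjoint_family_on_def pair_eq_iff)
    have K3: "card {pair k m} = 1" for m by simp
    have W: "Measurable.pred (borel \<Otimes>\<^sub>M borel \<Otimes>\<^sub>M borel) (\<lambda>(p, q, z). F p q z)"
      unfolding F_def by (rule measurable_forward_region)
    note * = link_failure_prob[OF kj W v _ \<alpha>(2) _ _ K1 K3 K2]
    have s01: "0 \<le> s ^ ?d" "s ^ ?d \<le> 1" using s by (auto intro: power_le_one)
    have t: "0 \<le> \<alpha> * s ^ ?d" "\<alpha> * s ^ ?d \<le> 1" using \<alpha> s01 by (auto intro: mult_le_one)
    show "BF k j \<in> S.events" unfolding BF_def Bad_def by (rule *) (use \<alpha> s01 in auto)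
    have "S.prob (BF k j) \<le> (1 - \<alpha> ^ 1 * s ^ ?d) ^ (n - 2)"
      unfolding BF_def Bad_def by (rule *) (use \<alpha> s01 in auto)
    also have "\<dots> \<le> exp (- (\<alpha> * s ^ ?d * real (n - 2)))"
      using one_minus_power_le_exp[OF t] by simp
    also have "\<dots> \<le> \<delta>"
    proof -
      have "(3/5 :: real) ^ 3 \<le> (3/5) ^ ?d" using d by (intro power_decreasing) auto
      then have c: "27/125 \<le> (3/5 :: real) ^ ?d" by (simp add: power3_eq_cube)
      have "\<alpha> * s ^ ?d * real (n - 2) = (3/5) ^ ?d * (12 * ln (real n))"
        unfolding s_def power_mult_distrib r0_power using n \<alpha> by (simp add: of_nat_diff)
      moreover have "27/125 * (12 * ln (real n)) \<le> (3/5) ^ ?d * (12 * ln (real n))"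
        using c ln_pos by (intro mult_right_mono) auto
      ultimately show ?thesis using ln_pos by (simp add: \<delta>_def)
    qed
    finally show "S.prob (BF k j) \<le> \<delta>" .
  qed
  have BM: "BM k j \<in> S.events" "S.prob (BM k j) \<le> \<delta>" if kj: "k < n" "j < n" "k \<noteq> j" for k j
  proof -
    have v: "s' ^ ?d \<le> measure cube_measure {z. M p q z}"
      if "p \<in> cbox 0 One" "q \<in> cbox 0 One" for p q
      unfolding M_def using measure_middle_region[OF that s'_pos s'_le] by simp
    have K1: "{pair k m, pair j m} \<subseteq> {(i, j). i < j \<and> j < n}" if "m \<in> {..<n} - {k, j}" for m
      using pair_mem[of k n m] pair_mem[of j n m] that kj by auto
    have K2: "disjoint_family_on (\<lambda>m. {pair k m, pair j m}) ({..<n} - {k, j})"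
      by (auto simp: disjoint_family_on_def pair_eq_iff)
    have K3: "card {pair k m, pair j m} = 2" if "m \<in> {..<n} - {k, j}" for m
      using that kj by (auto simp: card_2_iff pair_eq_iff intro!: exI)
    have W: "Measurable.pred (borel \<Otimes>\<^sub>M borel \<Otimes>\<^sub>M borel) (\<lambda>(p, q, z). M p q z)"
      unfolding M_def by (rule measurable_middle_region)
    note * = link_failure_prob[OF kj W v _ \<alpha>(2) _ _ K1 K3 K2]
    have s01: "0 \<le> s' ^ ?d" "s' ^ ?d \<le> 1" using s'_pos s'_le by (auto intro: power_le_one)
    have t: "0 \<le> \<alpha>\<^sup>2 * s' ^ ?d" "\<alpha>\<^sup>2 * s' ^ ?d \<le> 1"
      using \<alpha> s01 by (auto intro!: mult_le_one power_le_one)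
    show "BM k j \<in> S.events" unfolding BM_def Bad_def by (rule *) (use \<alpha> s01 in auto)
    have "S.prob (BM k j) \<le> (1 - \<alpha>\<^sup>2 * s' ^ ?d) ^ (n - 2)"
      unfolding BM_def Bad_def by (rule *) (use \<alpha> s01 in auto)
    also have "\<dots> \<le> exp (- (\<alpha>\<^sup>2 * s' ^ ?d * real (n - 2)))"
      using one_minus_power_le_exp[OF t] by simp
    \<comment> \<open>The factor \<open>1 / \<alpha>\<close> contained in \<open>s' ^ ?d\<close>
      compensates for the second edge required at a common neighbour.\<close>
    also have "\<alpha>\<^sup>2 * s' ^ ?d * real (n - 2) = 12 * ln (real n)"
    proof -
      have "((1 / \<alpha>) powr (1 / real ?d)) ^ ?d = 1 / \<alpha>" using \<alpha> by (intro root_power) simp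
      then show ?thesis
        unfolding s'_def power_mult_distrib r0_power using n \<alpha> by (simp add: of_nat_diff power2_eq_square)
    qed
    also have "exp (- (12 * ln (real n))) \<le> \<delta>" using ln_pos by (simp add: \<delta>_def)
    finally show "S.prob (BM k j) \<le> \<delta>" .
  qed
  define \<eta> where "\<eta> = 2 * exp (- 2 * real n * (1/150)\<^sup>2)"
  define D1 where "D1 a = {\<omega> \<in> space ?\<Omega>. real n * (1/150) \<le> \<bar>(\<Sum>i<n. fst \<omega> i $ a) - real n * (1/2)\<bar>}" for a
  define D2 where "D2 = (\<lambda>(a, b). {\<omega> \<in> space ?\<Omega>. real n * (1/150)
      \<le> \<bar>(\<Sum>i<n. fst \<omega> i $ a * fst \<omega> i $ b) - real n * (if a = b then 1/3 else 1/4)\<bar>})"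
  have D1: "D1 a \<in> S.events" "S.prob (D1 a) \<le> \<eta>" for a
    unfolding D1_def \<eta>_def
    by (rule sample_mean_deviation_prob[OF _ _ _ _ integral_cube_coordinate];
        use n in \<open>auto simp: mem_unit_cube\<close>)+
  have D2: "D2 c \<in> S.events" "S.prob (D2 c) \<le> \<eta>" for c
    unfolding D2_def \<eta>_def case_prod_beta
    by (rule sample_mean_deviation_prob[OF _ _ _ _ integral_cube_coordinate_product];
        use n in \<open>auto simp: mem_unit_cube intro: mult_le_one\<close>)+
  \<comment> \<open>The space of a uniform measure is the whole of \<open>real^'d\<close>, so
    positions outside the cube are removed as a null set.\<close>
  define Out where "Out i = {\<omega> \<in> space ?\<Omega>. fst \<omega> i \<notin> cbox 0 One}" for i
  have Out: "Out i \<in> S.events" "S.prob (Out i) = 0" if "i < n" for i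
  proof -
    have comp: "(\<lambda>\<omega>. fst \<omega> i) \<in> borel_measurable ?\<Omega>"
      unfolding sample_space_def
      using measurable_compose[OF measurable_fst measurable_component_singleton, of i "{..<n}"] that
      by (simp cong: measurable_cong_sets)
    then show ev: "Out i \<in> S.events" unfolding Out_def by measurable
    have "AE \<omega> in ?\<Omega>. fst \<omega> i \<in> cbox 0 One" by (rule AE_sample_in_cube[OF that])
    then have "AE \<omega> in ?\<Omega>. \<omega> \<notin> Out i" by eventually_elim (auto simp: Out_def)
    then show "S.prob (Out i) = 0" using ev by (simp add: S.prob_eq_0)
  qed
  define P where "P = {(k, j). k < n \<and> j < n \<and> k \<noteq> j}"
  have P: "finite P" "card P \<le> n * n"
  proof -
    have sub: "P \<subseteq> {..<n} \<times> {..<n}" by (auto simp: P_def)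
    show "finite P" by (rule finite_subset[OF sub]) simp
    show "card P \<le> n * n" using card_mono[OF _ sub] by simp
  qed
  define B where "B = (\<Union>i<n. Out i) \<union> ((\<Union>(k, j)\<in>P. BF k j) \<union> ((\<Union>(k, j)\<in>P. BM k j) \<union> ((\<Union>a. D1 a) \<union> (\<Union>c. D2 c))))"
  have ev: "(\<Union>i<n. Out i) \<in> S.events" "(\<Union>(k, j)\<in>P. BF k j) \<in> S.events" "(\<Union>(k, j)\<in>P. BM k j) \<in> S.events"
    "(\<Union>a. D1 a) \<in> S.events" "(\<Union>c. D2 c) \<in> S.events"
    using Out BF BM D1 D2 P by (auto simp: P_def intro!: sets.finite_UN)
  have \<delta>0: "0 \<le> \<delta>" and \<eta>0: "0 \<le> \<eta>" by (auto simp: \<delta>_def \<eta>_def)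
  have union: "S.prob (\<Union>x\<in>X. G x) \<le> real N * b"
    if "finite X" "card X \<le> N" "\<And>x. x \<in> X \<Longrightarrow> G x \<in> S.events \<and> S.prob (G x) \<le> b" "0 \<le> b" for X :: "'x set" and G N b
  proof -
    have "S.prob (\<Union>x\<in>X. G x) \<le> (\<Sum>x\<in>X. S.prob (G x))"
      using that by (intro S.finite_measure_subadditive_finite) auto
    also have "\<dots> \<le> (\<Sum>x\<in>X. b)" using that by (intro sum_mono) auto
    also have "\<dots> \<le> real N * b" using that by (simp add: mult_right_mono)
    finally show ?thesis .
  qed
  have p1: "S.prob (\<Union>i<n. Out i) \<le> real n * 0" by (rule union) (auto simp: Out)
  have p2: "S.prob (\<Union>(k, j)\<in>P. BF k j) \<le> real (n * n) * \<delta>"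
    by (rule union) (use P \<delta>0 BF in \<open>auto simp: P_def\<close>)
  have p3: "S.prob (\<Union>(k, j)\<in>P. BM k j) \<le> real (n * n) * \<delta>"
    by (rule union) (use P \<delta>0 BM in \<open>auto simp: P_def\<close>)
  have p4: "S.prob (\<Union>a. D1 a) \<le> real 3 * \<eta>" by (rule union) (use D1 \<eta>0 d in auto)
  have p5: "S.prob (\<Union>c. D2 c) \<le> real 9 * \<eta>"
  proof (rule union)
    show "card (UNIV :: ('d \<times> 'd) set) \<le> 9" using mult_mono[OF d d] by (simp add: card_prod)
  qed (use D2 \<eta>0 in auto)
  have "S.prob B \<le> S.prob (\<Union>i<n. Out i) + (S.prob (\<Union>(k, j)\<in>P. BF k j)
      + (S.prob (\<Union>(k, j)\<in>P. BM k j) + (S.prob (\<Union>a. D1 a) + S.prob (\<Union>c. D2 c))))"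
    unfolding B_def
    by (intro measure_Un_le[THEN order_trans] add_left_mono order_refl sets.Un ev)
  also have "\<dots> \<le> 2 * (real n)\<^sup>2 * \<delta> + 24 * exp (- 2 * real n * (1/150)\<^sup>2)"
    using p1 p2 p3 p4 p5 by (simp add: \<eta>_def power2_eq_square)
  finally have B_le: "S.prob B \<le> 2 * (real n)\<^sup>2 * \<delta> + 24 * exp (- 2 * real n * (1/150)\<^sup>2)" .
  have B_ev: "B \<in> S.events" unfolding B_def using ev by auto
  define A where "A = space ?\<Omega> - B"
  have "good_event \<alpha> \<beta> R n \<omega>" if \<omega>: "\<omega> \<in> A" for \<omega>
  proof -
    obtain x U where xU: "\<omega> = (x, U)" by (cases \<omega>)
    have sp: "(x, U) \<in> space ?\<Omega>" and nB: "(x, U) \<notin> B" using \<omega> by (auto simp: A_def xU)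
    have cube: "x i \<in> cbox 0 One" if "i < n" for i
      using nB sp that by (auto simp: B_def Out_def)
    have linked: "all_linked n \<alpha> W (\<lambda>k j m. K k j m) x U"
      if "\<And>k j. (k, j) \<in> P \<Longrightarrow> (x, U) \<notin> Bad W (K k j) k j" for W K
      unfolding all_linked_def
    proof (intro allI impI)
      fix k j assume kj: "k < n" "j < n" "k \<noteq> j"
      then have "(x, U) \<notin> Bad W (K k j) k j" using that by (auto simp: P_def)
      then show "\<exists>m<n. m \<noteq> k \<and> m \<noteq> j \<and> W (x k) (x j) (x m) \<and> (\<forall>i\<in>K k j m. U i < \<alpha>)"
        using sp cube kj unfolding Bad_def by auto
    qed
    have fwd: "all_linked n \<alpha> F (\<lambda>k j m. {pair k m}) x U"
    proof (rule linked)
      fix k j assume "(k, j) \<in> P"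
      then show "(x, U) \<notin> Bad F (\<lambda>m. {pair k m}) k j" using nB unfolding B_def BF_def by blast
    qed
    have mid: "all_linked n \<alpha> M (\<lambda>k j m. {pair k m, pair j m}) x U"
    proof (rule linked)
      fix k j assume "(k, j) \<in> P"
      then show "(x, U) \<notin> Bad M (\<lambda>m. {pair k m, pair j m}) k j" using nB unfolding B_def BM_def by blast
    qed
    show ?thesis unfolding xU
    proof (rule good_eventI[OF d n \<alpha> \<beta> r0_pos _ s_def s'_ge s'_le R cube])
      show "R_MDS \<alpha> ?d n = 32 * r0" by (simp add: R_MDS_def r0_def)
      show "all_linked n \<alpha> (forward_region (R - s * sqrt (real ?d)) s) (\<lambda>k j m. {pair k m}) x U"
        using fwd by (simp add: F_def r_def)
      show "all_linked n \<alpha> (middle_region s') (\<lambda>k j m. {pair k m, pair j m}) x U"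
        using mid by (simp add: M_def)
      show "\<bar>(\<Sum>i<n. x i $ a) - real n / 2\<bar> \<le> real n / 150" for a
        using nB sp by (auto simp: B_def D1_def not_le dest: less_imp_le)
      show "\<bar>(\<Sum>i<n. x i $ a * x i $ b) - real n * (if a = b then 1/3 else 1/4)\<bar> \<le> real n / 150" for a b
      proof -
        have "(x, U) \<notin> D2 (a, b)" using nB unfolding B_def by blast
        then show ?thesis using sp unfolding D2_def case_prod_conv by simp
      qed
    qed
  qed
  moreover have "A \<in> S.events" using B_ev by (auto simp: A_def)
  moreover have "1 - (2 * (real n)\<^sup>2 * \<delta> + 24 * exp (- 2 * real n * (1/150)\<^sup>2)) \<le> S.prob A"
    unfolding A_def using B_le S.prob_compl[OF B_ev] by simp
  ultimately show ?thesis unfolding \<delta>_def by blast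
qed

section \<open>Passage to the limit\<close>

theorem theorem2:
  fixes \<alpha> \<beta> :: real and R :: "nat \<Rightarrow> real"
  assumes "CARD('d::finite) = 2 \<or> CARD('d) = 3"
    and "0 < \<alpha>" and "\<alpha> \<le> 1"
    and "0 \<le> \<beta>" and "\<beta> < real CARD('d)"
    and "\<forall>n\<ge>3. R n > (1 / \<alpha>) powr (1 / real CARD('d)) * R_MDS \<alpha> CARD('d) n"
  shows "\<exists>A :: nat \<Rightarrow> ((nat \<Rightarrow> real^'d) \<times> (nat \<times> nat \<Rightarrow> real)) set.
           (\<forall>n. A n \<in> sets (sample_space n)) \<and>
           (\<forall>n\<ge>3. \<forall>\<omega>\<in>A n. good_event \<alpha> \<beta> (R n) n \<omega>) \<and>
           (\<lambda>n. measure (sample_space n) (A n)) \<longlonglongrightarrow> 1"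
proof -
  define s' where "s' n = (1 / \<alpha>) powr (1 / real CARD('d)) *
    (12 * ln (real n) / (\<alpha> * (real n - 2))) powr (1 / real CARD('d))" for n :: nat
  define low where "low n = 1 - (2 * (real n)\<^sup>2 * exp (- (5/2 * ln (real n)))
    + 24 * exp (- 2 * real n * (1/150)\<^sup>2))" for n :: nat
  have "\<exists>A. A \<in> sets (sample_space n) \<and> (3 \<le> n \<longrightarrow> (\<forall>\<omega>\<in>A. good_event \<alpha> \<beta> (R n) n (\<omega> :: (nat \<Rightarrow> real^'d) \<times> _)))
      \<and> (3 \<le> n \<and> s' n \<le> 1 \<longrightarrow> low n \<le> measure (sample_space n) A)" for n
  \<comment> \<open>The cubes of side \<open>s' n\<close> must fit into the unit cube. Otherwise, or
    for \<open>n < 3\<close>, the empty set is taken; as \<open>s'\<close> tends to 0, this concerns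
    finitely many \<open>n\<close>.\<close>
  proof (cases "3 \<le> n \<and> s' n \<le> 1")
    case True
    then have "32 * s' n < R n" using assms(6) by (auto simp: s'_def R_MDS_def mult_ac)
    then show ?thesis
      using good_event_prob[where 'd = 'd, of n \<alpha> \<beta> "R n"] True assms unfolding s'_def low_def by auto
  next
    case False
    then show ?thesis by (intro exI[of _ "{}"]) auto
  qed
  then obtain A :: "nat \<Rightarrow> ((nat \<Rightarrow> real^'d) \<times> (nat \<times> nat \<Rightarrow> real)) set" where
    A: "\<And>n. A n \<in> sets (sample_space n)" "\<And>n \<omega>. 3 \<le> n \<Longrightarrow> \<omega> \<in> A n \<Longrightarrow> good_event \<alpha> \<beta> (R n) n \<omega>"
      "\<And>n. 3 \<le> n \<Longrightarrow> s' n \<le> 1 \<Longrightarrow> low n \<le> measure (sample_space n) (A n)"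
    by metis
  have "(\<lambda>n. 12 * ln (real n) / (\<alpha> * (real n - 2))) \<longlonglongrightarrow> 0"
    using assms(2) by real_asymp
  then have "(\<lambda>n. (12 * ln (real n) / (\<alpha> * (real n - 2))) powr (1 / real CARD('d))) \<longlonglongrightarrow> 0 powr (1 / real CARD('d))"
    by (rule tendsto_powr')
      (use assms(2) in \<open>auto intro!: eventually_sequentiallyI[of 3] divide_nonneg_nonneg\<close>)
  then have "s' \<longlonglongrightarrow> (1 / \<alpha>) powr (1 / real CARD('d)) * 0"
    unfolding s'_def by (intro tendsto_mult) auto
  then have "eventually (\<lambda>n. s' n < 1) sequentially"
    by (rule order_tendstoD) simp
  then have ev: "eventually (\<lambda>n. low n \<le> measure (sample_space n) (A n)) sequentially"
    using eventually_ge_at_top[of 3] by eventually_elim (auto intro: A(3))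
  \<comment> \<open>The exponential in the pair term is \<open>n powr (- 5/2)\<close>, so that term
    is \<open>2 * n powr (- 1/2)\<close>.\<close>
  have low: "low \<longlonglongrightarrow> 1" unfolding low_def by real_asymp
  have "(\<lambda>n. measure (sample_space n) (A n)) \<longlonglongrightarrow> 1"
    by (rule tendsto_sandwich[OF ev _ low tendsto_const])
      (auto intro!: always_eventually prob_space.prob_le_1 prob_space_sample_space)
  then show ?thesis using A(1,2) by blast
qed

end
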